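(* Let $\mathcal{D}$ be a reliable digraph property such that $d(\mathcal{D})\ge(1,1)$, and let $D$ be a connected digraph. Then $$\vec\chi_{\ell}(D:\mathcal{D})\le\max\Big\{\Big\lceil\frac{\Delta^+(D)}{d^+(\mathcal{D})}\Big\rceil,\Big\lceil\frac{\Delta^-(D)}{d^-(\mathcal{D})}\Big\rceil\Big\}$$ unless $D=K_1$, or $d^+(\mathcal{D})=d^-(\mathcal{D})=r\ge1$ and one of the following holds: (i) $D\in\mathrm{CR}(\mathcal{D})=\mathrm{Crit}(\mathcal{D},\vec\chi_\ell,2)$ and $D$ is $r$-diregular; (ii) $D=D^\pm(K_{kr+1})\in\mathrm{Crit}(\mathcal{D},\vec\chi_\ell,k+1)$ for some $k\ge1$; (iii) $r=1$ and $D=D^\pm(C_n)\in\mathrm{Crit}(\mathcal{D},\vec\chi_\ell,3)$ with $n\ge3$ odd.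
   Context: Digraphs are finite, without loops and parallel arcs (digons allowed). $\Delta^\pm(D)$ maximum out-/in-degree; pairs in $\mathbb{N}_0^2$ compared coordinatewise. $D$ is $r$-diregular if every vertex has in- and out-degree $r$. $K_1$ is the one-vertex digraph; $D^\pm(G)$ replaces each edge of undirected $G$ by a digon. Connected refers to the underlying graph. A digraph property is a class of digraphs closed under isomorphism; reliable means nontrivial (contains a nonempty digraph but not all digraphs), hereditary (closed under induced subdigraphs) and additive (closed under disjoint unions). $\mathrm{CR}(\mathcal{D})$: digraphs $D\notin\mathcal{D}$ with $D-v\in\mathcal{D}$ for all $v$; $d(\mathcal{D})=(d^+(\mathcal{D}),d^-(\mathcal{D}))$ with $d^\pm(\mathcal{D})=\min\{\delta^\pm(D):D\in\mathrm{CR}(\mathcal{D})\}$. A list assignment $L$ of $D$ assigns a set $L(v)$ to each vertex; it is a $k$-assignment if $|L(v)|\ge k$ for all $v$. A $(\mathcal{D},L)$-coloring is a map $\varphi$ with $\varphi(v)\in L(v)$ and $D[\varphi^{-1}(c)]\in\mathcal{D}$ for every color $c$. $\vec\chi_\ell(D:\mathcal{D})$ is the least $k$ such that $D$ has a $(\mathcal{D},L)$-coloring for every $k$-assignment $L$. $D\in\mathrm{Crit}(\mathcal{D},\vec\chi_\ell,k)$ if $\vec\chi_\ell(D':\mathcal{D})<\vec\chi_\ell(D:\mathcal{D})=k$ for every proper induced subdigraph $D'$ of $D$. *)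

theory Defs
  imports
    Complex_Main
    "HOL-Library.Infinite_Typeclass"
    "Graph_Theory.Graph_Theory"
begin

text \<open>
  A digraph is a \<^locale>\<open>pair_digraph\<close>: finite, loop-free, and without parallel arcs because the
  arcs form a set of ordered pairs. The digraph without vertices is included.
\<close>

definition induced :: "'v pair_pre_digraph \<Rightarrow> 'v set \<Rightarrow> 'v pair_pre_digraph" where
  "induced D S = \<lparr>pverts = S, parcs = {a \<in> parcs D. fst a \<in> S \<and> snd a \<in> S}\<rparr>"

lemma with_proj_induced: "with_proj (induced D S) = with_proj D \<restriction> S"
  by (simp add: induced_def with_proj_def induce_subgraph_def)

definition dunion :: "'v pair_pre_digraph \<Rightarrow> 'v pair_pre_digraph \<Rightarrow> 'v pair_pre_digraph" where
  "dunion D D' = \<lparr>pverts = pverts D \<union> pverts D', parcs = parcs D \<union> parcs D'\<rparr>"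

lemma with_proj_dunion: "with_proj (dunion D D') = union (with_proj D) (with_proj D')"
  by (simp add: dunion_def with_proj_def union_def)

text \<open>The minima and maxima below are meant for digraphs with at least one vertex.\<close>

definition max_out_degree :: "'v pair_pre_digraph \<Rightarrow> nat" where
  "max_out_degree D = Max (out_degree (with_proj D) ` pverts D)"

definition max_in_degree :: "'v pair_pre_digraph \<Rightarrow> nat" where
  "max_in_degree D = Max (in_degree (with_proj D) ` pverts D)"

definition min_out_degree :: "'v pair_pre_digraph \<Rightarrow> nat" where
  "min_out_degree D = Min (out_degree (with_proj D) ` pverts D)"

definition min_in_degree :: "'v pair_pre_digraph \<Rightarrow> nat" where
  "min_in_degree D = Min (in_degree (with_proj D) ` pverts D)"

definition diregular :: "nat \<Rightarrow> 'v pair_pre_digraph \<Rightarrow> bool" where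
  "diregular r D \<longleftrightarrow>
     (\<forall>v \<in> pverts D. out_degree (with_proj D) v = r \<and> in_degree (with_proj D) v = r)"

text \<open>
  A digraph property is represented by its members with vertices in a type 'v. If 'v is infinite,
  every finite digraph has a copy over 'v, and any two digraphs have disjoint copies over 'v,
  so closure under isomorphism makes this lose nothing.
\<close>

definition digraph_property :: "'v pair_pre_digraph set \<Rightarrow> bool" where
  "digraph_property P \<longleftrightarrow>
     (\<forall>D \<in> P. pair_digraph D) \<and>
     (\<forall>D \<in> P. \<forall>D'. digraph_iso (with_proj D) (with_proj D') \<longrightarrow> D' \<in> P)"

definition nontrivial :: "'v pair_pre_digraph set \<Rightarrow> bool" where
  "nontrivial P \<longleftrightarrow> (\<exists>D \<in> P. pverts D \<noteq> {}) \<and> (\<exists>D. pair_digraph D \<and> D \<notin> P)"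

definition hereditary :: "'v pair_pre_digraph set \<Rightarrow> bool" where
  "hereditary P \<longleftrightarrow> (\<forall>D \<in> P. \<forall>S \<subseteq> pverts D. induced D S \<in> P)"

definition additive :: "'v pair_pre_digraph set \<Rightarrow> bool" where
  "additive P \<longleftrightarrow>
     (\<forall>D \<in> P. \<forall>D' \<in> P. pverts D \<inter> pverts D' = {} \<longrightarrow> dunion D D' \<in> P)"

definition reliable :: "'v pair_pre_digraph set \<Rightarrow> bool" where
  "reliable P \<longleftrightarrow> digraph_property P \<and> nontrivial P \<and> hereditary P \<and> additive P"

definition CR :: "'v pair_pre_digraph set \<Rightarrow> 'v pair_pre_digraph set" where
  "CR P = {D. pair_digraph D \<and> D \<notin> P \<and> (\<forall>v \<in> pverts D. induced D (pverts D - {v}) \<in> P)}"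

text \<open>
  For a reliable property over an infinite type, \<^const>\<open>CR\<close> is nonempty and all its members have
  a vertex, so the infima in the next two definitions are minima.
\<close>

definition d_out :: "'v pair_pre_digraph set \<Rightarrow> nat" where
  "d_out P = (INF D \<in> CR P. min_out_degree D)"

definition d_in :: "'v pair_pre_digraph set \<Rightarrow> nat" where
  "d_in P = (INF D \<in> CR P. min_in_degree D)"

text \<open>
  Colors are natural numbers. This is no restriction: a list assignment of a finite digraph can
  be thinned to finite lists, which involve finitely many colors. Lists may be infinite, which has
  to be treated separately because \<^const>\<open>card\<close> is 0 on infinite sets.
\<close>

definition k_assignment :: "'v pair_pre_digraph \<Rightarrow> nat \<Rightarrow> ('v \<Rightarrow> nat set) \<Rightarrow> bool" where
  "k_assignment D k L \<longleftrightarrow> (\<forall>v \<in> pverts D. infinite (L v) \<or> k \<le> card (L v))"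

definition list_coloring ::
  "'v pair_pre_digraph set \<Rightarrow> 'v pair_pre_digraph \<Rightarrow> ('v \<Rightarrow> nat set) \<Rightarrow> ('v \<Rightarrow> nat) \<Rightarrow> bool" where
  "list_coloring P D L \<phi> \<longleftrightarrow>
     (\<forall>v \<in> pverts D. \<phi> v \<in> L v) \<and> (\<forall>c. induced D {v \<in> pverts D. \<phi> v = c} \<in> P)"

definition list_chi :: "'v pair_pre_digraph set \<Rightarrow> 'v pair_pre_digraph \<Rightarrow> nat" where
  "list_chi P D = (LEAST k. \<forall>L. k_assignment D k L \<longrightarrow> (\<exists>\<phi>. list_coloring P D L \<phi>))"

definition list_crit :: "'v pair_pre_digraph set \<Rightarrow> nat \<Rightarrow> 'v pair_pre_digraph set" where
  "list_crit P k =
     {D. pair_digraph D \<and> list_chi P D = k \<and>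
         (\<forall>S. S \<subset> pverts D \<longrightarrow> list_chi P (induced D S) < list_chi P D)}"

text \<open>
  An undirected graph is a pair of its vertex set and its edge set, edges being two-element
  vertex sets.
\<close>

definition bidirected :: "'a set \<times> 'a set set \<Rightarrow> 'a pair_pre_digraph" where
  "bidirected G = \<lparr>pverts = fst G, parcs = {(u, v). u \<noteq> v \<and> {u, v} \<in> snd G}\<rparr>"

definition complete_ugraph :: "nat \<Rightarrow> nat set \<times> nat set set" where
  "complete_ugraph n = ({..<n}, {{u, v} | u v. u < n \<and> v < n \<and> u \<noteq> v})"

definition cycle_ugraph :: "nat \<Rightarrow> nat set \<times> nat set set" where
  "cycle_ugraph n = ({..<n}, {{i, (i + 1) mod n} | i. i < n})"

definition K1 :: "nat pair_pre_digraph" where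
  "K1 = \<lparr>pverts = {0}, parcs = {}\<rparr>"

end

theory Submission
  imports Defs
begin

text \<open>
  Let k be the right-hand side, and suppose that some lists of size k admit no coloring. Take a
  minimal induced subdigraph without a coloring. If a vertex v of it is left uncolored, then each
  color c in L(v), when used at v, creates a member of CR through v. So c occurs on at least
  d+ out-neighbors and d- in-neighbors of v, and v has out- and in-degree at least k d+ and k d-.
  By the choice of k this is the degree of v in D, so the minimal subdigraph is D itself, and
  counting arcs gives d+ = d- = r.

  Now each color of L(v) occurs on exactly r out- and r in-neighbors of the uncolored vertex v,
  the hole, and the color of any neighbor w can be shifted to v, which moves the hole to w. Moving
  the hole once around a cycle through v rotates the colors of the other vertices, so the number of
  neighbors of v with a given color on the cycle is invariant under rotation. If only the two ends
  of the path left by v are neighbors of v, the path is either monochromatic, or its colors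
  alternate, its order is even, and v is joined to both ends by arcs of the same directions.

  For k > 1, compare such paths for a vertex v that is not a cut vertex. If one of them has at least
  three vertices, parity leaves v no neighbors except its two ends, and a shortest such path closes
  up to all of D, an odd cycle of digons. If there is no such path, the vertices of an
  end piece of D are pairwise adjacent, by digons because of the triangles, and fill up D.
\<close>

section \<open>Color sequences on cycles\<close>

text \<open>Indices are taken modulo the length, so for an odd length all entries coincide.\<close>

definition period2 :: "'a list \<Rightarrow> bool" where
  "period2 cs \<longleftrightarrow> (\<forall>i. cs ! ((i + 2) mod length cs) = cs ! (i mod length cs))"

definition monochrome :: "('v \<Rightarrow> 'c) \<Rightarrow> 'v list \<Rightarrow> bool" where
  "monochrome \<phi> p \<longleftrightarrow> (\<forall>a\<in>set p. \<forall>b\<in>set p. \<phi> a = \<phi> b)"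

text \<open>One coincidence of cyclically consecutive entries merges the two residue classes:
  walking on from \<open>i\<close>, every pair of consecutive entries repeats the same
  value.\<close>

lemma period2_const:
  assumes "period2 cs" "cs ! (i mod length cs) = cs ! (Suc i mod length cs)" "a \<in> set cs" "b \<in> set cs"
  shows "a = b"
proof -
  let ?n = "length cs"
  have n: "?n > 0" using assms(3) by (auto simp: length_pos_if_in_set)
  have step: "cs ! ((i + j) mod ?n) = cs ! (i mod ?n) \<and> cs ! ((i + Suc j) mod ?n) = cs ! (i mod ?n)" for j
  proof (induction j)
    case 0 then show ?case using assms(2) by simp
  next
    case (Suc j)
    have "cs ! ((i + j + 2) mod ?n) = cs ! ((i + j) mod ?n)"
      using assms(1) unfolding period2_def by blast
    with Suc show ?case by simp
  qed
  have all: "x = cs ! (i mod ?n)" if x: "x \<in> set cs" for x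
  proof -
    obtain j where j: "j < ?n" "x = cs ! j" using x by (auto simp: in_set_conv_nth)
    \<comment> \<open>This offset leads forward from \<open>i\<close> to \<open>j\<close>, so the
      induction on the distance reaches every index.\<close>
    have "(i + (j + (?n - i mod ?n))) mod ?n = j"
    proof -
      have "(i + (j + (?n - i mod ?n))) mod ?n = (i mod ?n + (j + (?n - i mod ?n))) mod ?n"
        by (simp add: mod_add_left_eq)
      also have "i mod ?n + (j + (?n - i mod ?n)) = j + ?n"
        using mod_less_divisor[OF n, of i] by linarith
      finally show ?thesis using j by simp
    qed
    with step[of "j + (?n - i mod ?n)"] j show ?thesis by simp
  qed
  show ?thesis using all[OF assms(3)] all[OF assms(4)] by simp
qed

lemma period2_odd_const:
  assumes "period2 cs" "odd (length cs)" "a \<in> set cs" "b \<in> set cs"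
  shows "a = b"
proof -
  let ?n = "length cs"
  have even: "cs ! ((2 * j) mod ?n) = cs ! (0 mod ?n)" for j
  proof (induction j)
    case (Suc j)
    have "cs ! ((2 * j + 2) mod ?n) = cs ! ((2 * j) mod ?n)"
      using assms(1) unfolding period2_def by blast
    with Suc show ?case by simp
  qed simp
  obtain m where m: "?n = 2 * m + 1" using assms(2) by (auto elim: oddE)
  \<comment> \<open>As \<open>?n = 2 * m + 1\<close>, going \<open>m + 1\<close> double steps from
    index 0 wraps around to index 1.\<close>
  have "cs ! ((2 * (m + 1)) mod ?n) = cs ! (Suc 0 mod ?n)"
  proof -
    have "2 * (m + 1) = Suc 0 + ?n" using m by simp
    then show ?thesis by (metis mod_add_self2)
  qed
  with even[of "m+1"] have "cs ! (0 mod ?n) = cs ! (Suc 0 mod ?n)" by simp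
  then show ?thesis using period2_const[OF assms(1) _ assms(3,4)] by blast
qed

lemma period2_consec_const:
  assumes "period2 (us @ a # b # vs)" "a = b" "x \<in> set (us @ a # b # vs)" "y \<in> set (us @ a # b # vs)"
  shows "x = y"
  by (rule period2_const[OF assms(1) _ assms(3,4), where i="length us"])
     (use assms(2) in \<open>auto simp: nth_append\<close>)

lemma period2_ends_const:
  assumes "period2 cs" "cs \<noteq> []" "hd cs = last cs" "a \<in> set cs" "b \<in> set cs"
  shows "a = b"
  by (rule period2_const[OF assms(1) _ assms(4,5), where i="length cs - 1"])
     (use assms(2,3) in \<open>auto simp: hd_conv_nth last_conv_nth\<close>)

lemma period2_of_const:
  assumes "cs \<noteq> []" "\<And>a b. a \<in> set cs \<Longrightarrow> b \<in> set cs \<Longrightarrow> a = b"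
  shows "period2 cs"
  unfolding period2_def by (intro allI assms(2) nth_mem) (use assms(1) in auto)

section \<open>Counting color classes among neighbors\<close>

lemma colors_in_list:
  fixes \<phi> :: "'v \<Rightarrow> 'c"
  assumes "finite N" "finite C" "card N = card C * r"
    and "\<And>c. c \<in> C \<Longrightarrow> card {w \<in> N. \<phi> w = c} = r"
    and "w \<in> N"
  shows "\<phi> w \<in> C"
proof -
  \<comment> \<open>The classes of the colors in \<open>C\<close> are disjoint and their sizes add
    up to \<open>card N\<close>, so no element is left for another color.\<close>
  have "card {w \<in> N. \<phi> w \<in> C} = card (\<Union>c\<in>C. {w \<in> N. \<phi> w = c})"
    by (rule arg_cong[where f=card]) auto
  also have "\<dots> = (\<Sum>c\<in>C. card {w \<in> N. \<phi> w = c})"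
    by (rule card_UN_disjoint) (use assms(1,2) in auto)
  also have "\<dots> = card N" using assms(3,4) by simp
  finally have "{w \<in> N. \<phi> w \<in> C} = N" using assms(1) by (intro card_subset_eq) auto
  then show ?thesis using assms(5) by blast
qed

lemma monochrome_map:
  "monochrome \<phi> p \<longleftrightarrow> (\<forall>a\<in>set (map \<phi> p). \<forall>b\<in>set (map \<phi> p). a = b)"
  by (auto simp: monochrome_def)

lemma Suc_mod_eq_iff: "a < n \<Longrightarrow> b < n \<Longrightarrow> Suc a mod n = Suc b mod n \<longleftrightarrow> a = b"
  by (auto simp: mod_Suc split: if_splits)

lemma cyclic_neighbours:
  assumes "3 \<le> n" "i < n"
  obtains j l where "j < n" "l < n" "j \<noteq> l" "j = Suc i mod n" "i = Suc l mod n"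
proof (cases i)
  case 0
  then show thesis using that[of 1 "n - 1"] assms by auto
next
  case (Suc l)
  show thesis
  proof (cases "Suc i = n")
    case True
    then show ?thesis using that[of 0 l] assms Suc by auto
  next
    case False
    then show ?thesis using that[of "Suc i" l] assms Suc by auto
  qed
qed

lemma single_color:
  assumes "card {w\<in>{x}. f w = f x} = card {w\<in>{x}. g w = f x}"
  shows "g x = f x"
proof (rule ccontr)
  assume "g x \<noteq> f x"
  then have "{w\<in>{x}. g w = f x} = {}" "{w\<in>{x}. f w = f x} = {x}" by auto
  with assms show False by (metis card.empty card_1_singleton_iff zero_neq_one is_singletonI is_singleton_altdef)
qed

lemma sum_color_classes:
  fixes \<phi> :: "'v \<Rightarrow> 'c"
  assumes "finite N" "finite C"
  shows "(\<Sum>c\<in>C. card {w \<in> N. \<phi> w = c}) \<le> card N"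
proof -
  have "(\<Sum>c\<in>C. card {w \<in> N. \<phi> w = c}) = card (\<Union>c\<in>C. {w \<in> N. \<phi> w = c})"
    by (rule card_UN_disjoint[symmetric]) (use assms in auto)
  also have "\<dots> \<le> card N" using assms(1) by (intro card_mono) auto
  finally show ?thesis .
qed

text \<open>The class sizes add up to at most \<open>card C * r\<close>, which is already the sum of
  their lower bounds, so every bound is attained.\<close>

lemma color_class_exact:
  fixes \<phi> :: "'v \<Rightarrow> 'c"
  assumes "finite N" "finite C" "card N = card C * r" "\<And>c. c \<in> C \<Longrightarrow> r \<le> card {w\<in>N. \<phi> w = c}" "c \<in> C"
  shows "card {w\<in>N. \<phi> w = c} = r"
proof -
  have "(\<Sum>c\<in>C. card {w\<in>N. \<phi> w = c}) \<le> (\<Sum>c\<in>C. r)"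
    using sum_color_classes[OF assms(1,2), of \<phi>] assms(3) by simp
  moreover have "(\<Sum>c\<in>C. r) \<le> (\<Sum>c\<in>C. card {w\<in>N. \<phi> w = c})"
    by (rule sum_mono) (rule assms(4))
  ultimately have "(\<Sum>c\<in>C. r) = (\<Sum>c\<in>C. card {w\<in>N. \<phi> w = c})" by (rule antisym[rotated])
  from sum_mono_inv[OF this assms(4) assms(5) assms(2)] show ?thesis by simp
qed

section \<open>Paths and induced cycles\<close>

locale finite_arcs =
  fixes V :: "'v set" and E :: "('v \<times> 'v) set"
  assumes finite_V: "finite V"
    and arcs_V: "E \<subseteq> V \<times> V"
    and loopfree: "(v, v) \<notin> E"
begin

definition adj :: "'v \<Rightarrow> 'v \<Rightarrow> bool" where
  "adj a b \<longleftrightarrow> (a, b) \<in> E \<or> (b, a) \<in> E"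

text \<open>The closure is reflexive at every vertex, also outside \<open>T\<close>, so membership
  of the starting point in \<open>T\<close> has to be carried along separately.\<close>

definition conn :: "'v set \<Rightarrow> ('v \<times> 'v) set" where
  "conn T = {(a, b). a \<in> T \<and> b \<in> T \<and> adj a b}\<^sup>*"

lemma adj_sym: "adj a b \<longleftrightarrow> adj b a"
  by (auto simp: adj_def)

lemma adj_irrefl [simp]: "\<not> adj a a"
  by (simp add: adj_def loopfree)

lemma adj_V: "adj a b \<Longrightarrow> a \<in> V \<and> b \<in> V"
  using arcs_V by (auto simp: adj_def)

lemma conn_refl [simp]: "(a, a) \<in> conn T"
  by (simp add: conn_def)

lemma conn_step: "a \<in> T \<Longrightarrow> b \<in> T \<Longrightarrow> adj a b \<Longrightarrow> (a, b) \<in> conn T"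
  by (auto simp: conn_def)

lemma conn_trans: "(a, b) \<in> conn T \<Longrightarrow> (b, c) \<in> conn T \<Longrightarrow> (a, c) \<in> conn T"
  unfolding conn_def by (rule rtrancl_trans)

lemma conn_sym: "(a, b) \<in> conn T \<Longrightarrow> (b, a) \<in> conn T"
proof -
  have "sym {(a, b). a \<in> T \<and> b \<in> T \<and> adj a b}"
    by (auto simp: sym_def adj_sym)
  then have "sym (conn T)" unfolding conn_def by (rule sym_rtrancl)
  then show "(a, b) \<in> conn T \<Longrightarrow> (b, a) \<in> conn T" by (rule symD)
qed

lemma conn_mono: "T \<subseteq> T' \<Longrightarrow> (a, b) \<in> conn T \<Longrightarrow> (a, b) \<in> conn T'"
  unfolding conn_def by (rule subsetD[OF rtrancl_mono]) auto

lemma conn_closed: "(a, b) \<in> conn T \<Longrightarrow> a \<in> T \<Longrightarrow> b \<in> T"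
  unfolding conn_def by (induction rule: rtrancl_induct) auto

lemma conn_avoid:
  assumes "(b, z) \<in> conn T" "(b, u) \<notin> conn T"
  shows "(b, z) \<in> conn (T - {u})"
  using assms(1) unfolding conn_def
proof (induction rule: rtrancl_induct)
  case (step y z)
  have "(b, y) \<in> conn T" using step(1) by (simp add: conn_def)
  moreover have "(b, z) \<in> conn T" using step(1,2) unfolding conn_def by (rule rtrancl_into_rtrancl)
  ultimately have "y \<noteq> u" "z \<noteq> u" using assms(2) by auto
  with step(2) have "(y, z) \<in> {(a, b). a \<in> T - {u} \<and> b \<in> T - {u} \<and> adj a b}" by auto
  with step(3) show ?case by (rule rtrancl_into_rtrancl)
qed simp

text \<open>On a walk from \<open>a\<close> to \<open>b\<close>, \<open>x\<close> is the first
  vertex in \<open>X\<close> and \<open>s\<close> its predecessor, so everything up to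
  \<open>s\<close> happens outside \<open>X\<close>.\<close>

lemma first_hit:
  assumes "(a, b) \<in> conn T" "a \<in> T" "a \<notin> X" "b \<in> X"
  obtains s x where "(a, s) \<in> conn (T - X)" "s \<in> T - X" "x \<in> X" "x \<in> T" "adj s x"
proof -
  have "(a, b) \<in> conn (T - X) \<and> b \<notin> X \<or> (\<exists>s x. (a, s) \<in> conn (T - X) \<and> s \<in> T - X \<and> x \<in> X \<and> x \<in> T \<and> adj s x)"
    using assms(1) unfolding conn_def
  proof (induction rule: rtrancl_induct)
    case base show ?case using assms(3) by simp
  next
    case (step y z)
    show ?case
    proof (cases "\<exists>s x. (a, s) \<in> {(a, b). a \<in> T - X \<and> b \<in> T - X \<and> adj a b}\<^sup>* \<and> s \<in> T - X \<and> x \<in> X \<and> x \<in> T \<and> adj s x")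
      case False
      with step(3) have y: "(a, y) \<in> {(a, b). a \<in> T - X \<and> b \<in> T - X \<and> adj a b}\<^sup>*" "y \<notin> X" by auto
      with False step(2) have "z \<notin> X" by blast
      with y step(2) have "(y, z) \<in> {(a, b). a \<in> T - X \<and> b \<in> T - X \<and> adj a b}" by auto
      with y(1) have "(a, z) \<in> {(a, b). a \<in> T - X \<and> b \<in> T - X \<and> adj a b}\<^sup>*"
        by (rule rtrancl_into_rtrancl)
      with \<open>z \<notin> X\<close> show ?thesis by simp
    qed simp
  qed
  with assms(4) that show thesis by blast
qed

lemma closed_eq_V:
  assumes "\<And>a b. a \<in> V \<Longrightarrow> b \<in> V \<Longrightarrow> (a, b) \<in> conn V"
    and "S \<subseteq> V" "S \<noteq> {}" "\<And>a w. a \<in> S \<Longrightarrow> adj a w \<Longrightarrow> w \<in> S"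
  shows "S = V"
proof (rule ccontr)
  assume "S \<noteq> V"
  then obtain a b where ab: "a \<in> S" "b \<in> V" "b \<notin> S" using assms by blast
  then have "(a, b) \<in> conn V" using assms(1,2) by blast
  from first_hit[OF this, of "- S"] ab assms(2) obtain s x where
    "s \<in> S" "x \<notin> S" "adj s x" by (metis Compl_iff DiffE subsetD)
  then show False using assms(4) by blast
qed

lemma finite_nbrs: "finite {w. (v, w) \<in> E}" "finite {w. (w, v) \<in> E}"
  by (rule finite_subset[OF _ finite_V], use arcs_V in auto)+

definition path :: "'v list \<Rightarrow> bool" where
  "path p \<longleftrightarrow> p \<noteq> [] \<and> distinct p \<and> successively adj p"

lemma path_rev: "path p \<Longrightarrow> path (rev p)"
  unfolding path_def by (simp add: adj_sym)

lemma path_append: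
  "path (p @ q) \<longleftrightarrow> (if p = [] then path q else if q = [] then path p else
     path p \<and> path q \<and> adj (last p) (hd q) \<and> set p \<inter> set q = {})"
  by (auto simp: path_def successively_append_iff)

lemma path_Cons: "path (a # p) \<longleftrightarrow> p = [] \<or> path p \<and> adj a (hd p) \<and> a \<notin> set p"
  by (auto simp: path_def successively_Cons)

lemma conn_path:
  assumes "(a, b) \<in> conn T" "a \<in> T"
  shows "\<exists>p. path p \<and> hd p = a \<and> last p = b \<and> set p \<subseteq> T"
  using assms(1) unfolding conn_def
proof (induction rule: rtrancl_induct)
  case base
  show ?case using assms(2) by (intro exI[of _ "[a]"]) (simp add: path_def)
next
  case (step y z)
  then obtain p where p: "path p" "hd p = a" "last p = y" "set p \<subseteq> T" by blast
  from p(1) have ne: "p \<noteq> []" by (simp add: path_def)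
  show ?case
  proof (cases "z \<in> set p")
    \<comment> \<open>A walk that returns to a vertex of the path is cut back to that
      vertex.\<close>
    case True
    then obtain us vs where "p = us @ z # vs" by (auto simp: in_set_conv_decomp)
    then have p': "p = (us @ [z]) @ vs" by simp
    have "path (us @ [z])" using p(1) unfolding p' path_append by (auto split: if_splits)
    moreover have "hd (us @ [z]) = a" using p(2) unfolding p' by (cases us) auto
    ultimately show ?thesis using p(4) unfolding p' by (intro exI[of _ "us @ [z]"]) auto
  next
    case False
    with p ne step(2) show ?thesis
      by (intro exI[of _ "p @ [z]"]) (auto simp: path_append, simp add: path_def)
  qed
qed

text \<open>With \<open>h\<close> added, the path closes to a cycle of length at least three on
  which \<open>h\<close> has no chord. Chords between the other vertices are allowed.\<close>

definition link :: "'v \<Rightarrow> 'v list \<Rightarrow> bool" where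
  "link h p \<longleftrightarrow> 2 \<le> length p \<and> path p \<and> h \<notin> set p \<and> adj h (hd p) \<and> adj h (last p)
     \<and> (\<forall>w\<in>set p. adj h w \<longrightarrow> w = hd p \<or> w = last p)"

lemma link_rev: "link h p \<Longrightarrow> link h (rev p)"
  unfolding link_def by (auto simp: path_rev hd_rev last_rev)

lemma link_nonempty: "link h p \<Longrightarrow> p \<noteq> []"
  by (auto simp: link_def)

definition induced_cycle :: "'v list \<Rightarrow> bool" where
  "induced_cycle cs \<longleftrightarrow> 3 \<le> length cs \<and> distinct cs \<and>
     (\<forall>i<length cs. \<forall>j<length cs.
        adj (cs ! i) (cs ! j) \<longleftrightarrow> j = Suc i mod length cs \<or> i = Suc j mod length cs)"

lemma induced_cycle_rotate1:
  assumes "induced_cycle cs"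
  shows "induced_cycle (rotate1 cs)"
proof -
  let ?n = "length cs"
  have n: "3 \<le> ?n" "distinct cs" using assms by (auto simp: induced_cycle_def)
  have "adj (rotate1 cs ! i) (rotate1 cs ! j) \<longleftrightarrow> j = Suc i mod ?n \<or> i = Suc j mod ?n"
    if ij: "i < ?n" "j < ?n" for i j
  proof -
    have m: "Suc a mod ?n < ?n" for a using n(1) by (intro mod_less_divisor) auto
    have "adj (rotate1 cs ! i) (rotate1 cs ! j) \<longleftrightarrow> adj (cs ! (Suc i mod ?n)) (cs ! (Suc j mod ?n))"
      using ij by (simp add: nth_rotate1)
    also have "\<dots> \<longleftrightarrow> Suc j mod ?n = Suc (Suc i mod ?n) mod ?n \<or> Suc i mod ?n = Suc (Suc j mod ?n) mod ?n"
      using assms m by (simp add: induced_cycle_def)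
    also have "\<dots> \<longleftrightarrow> j = Suc i mod ?n \<or> i = Suc j mod ?n"
      using Suc_mod_eq_iff[OF ij(2) m[of i]] Suc_mod_eq_iff[OF ij(1) m[of j]] by simp
    finally show ?thesis .
  qed
  then show ?thesis using n by (simp add: induced_cycle_def)
qed

lemma induced_cycle_rotate: "induced_cycle cs \<Longrightarrow> induced_cycle (rotate s cs)"
  by (induction s) (auto intro: induced_cycle_rotate1)

lemma induced_triangle:
  assumes "distinct [a, b, c]" "adj a b" "adj b c" "adj c a"
  shows "induced_cycle [a, b, c]"
proof -
  have sym: "adj b a" "adj c b" "adj a c" using assms adj_sym by blast+
  have "adj ([a, b, c] ! i) ([a, b, c] ! j) \<longleftrightarrow> j = Suc i mod 3 \<or> i = Suc j mod 3"
    if "i < 3" "j < 3" for i j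
  proof -
    have "i = 0 \<or> i = 1 \<or> i = 2" "j = 0 \<or> j = 1 \<or> j = 2" using that by auto
    then show ?thesis using assms sym by (elim disjE) simp_all
  qed
  then show ?thesis using assms(1) by (simp add: induced_cycle_def)
qed

text \<open>A rotation brings any vertex of an induced cycle to the front, so the results on links
  become available at each of its vertices.\<close>

lemma induced_cycle_link:
  assumes "induced_cycle (h # p)"
  shows "link h p"
proof -
  let ?cs = "h # p" and ?n = "Suc (length p)"
  have n: "2 \<le> length p" "distinct ?cs" using assms by (auto simp: induced_cycle_def)
  have a: "adj (?cs ! i) (?cs ! j) \<longleftrightarrow> j = Suc i mod ?n \<or> i = Suc j mod ?n"
    if "i < ?n" "j < ?n" for i j
    using assms that unfolding induced_cycle_def by (metis length_Cons)
  have ne: "p \<noteq> []" using n(1) by auto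
  have "adj (p ! i) (p ! Suc i)" if "Suc i < length p" for i
    using a[of "Suc i" "Suc (Suc i)"] that by simp
  moreover have "adj h (hd p)" using a[of 0 1] n ne by (simp add: hd_conv_nth)
  moreover have "adj h (last p)" using a[of 0 "length p"] n ne by (simp add: last_conv_nth)
  moreover have "w = hd p \<or> w = last p" if w: "w \<in> set p" "adj h w" for w
  proof -
    obtain i where i: "i < length p" "w = p ! i" using w(1) by (auto simp: in_set_conv_nth)
    then have "Suc i = Suc 0 mod ?n \<or> 0 = Suc (Suc i) mod ?n" using a[of 0 "Suc i"] w(2) by simp
    then have "i = 0 \<or> i = length p - 1" using i(1) n(1) by (auto simp: mod_Suc split: if_splits)
    then show ?thesis using i(2) ne by (auto simp: hd_conv_nth last_conv_nth)
  qed
  ultimately show ?thesis using n ne by (auto simp: link_def path_def successively_conv_nth)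
qed

end

section \<open>Moving an uncolored vertex\<close>

text \<open>
  Here \<^term>\<open>good h \<phi>\<close> stands for: \<^term>\<open>\<phi>\<close> is a coloring of the digraph without the
  vertex h. The value of \<^term>\<open>\<phi>\<close> at h itself is irrelevant.
\<close>

locale hole_coloring = finite_arcs V E for V :: "'v set" and E +
  fixes L :: "'v \<Rightarrow> nat set" and k r :: nat and good :: "'v \<Rightarrow> ('v \<Rightarrow> nat) \<Rightarrow> bool"
  assumes k2: "2 \<le> k" and r1: "1 \<le> r"
    and cardL: "v \<in> V \<Longrightarrow> card (L v) = k"
    and out_card: "v \<in> V \<Longrightarrow> card {w. (v, w) \<in> E} = k * r"
    and in_card: "v \<in> V \<Longrightarrow> card {w. (w, v) \<in> E} = k * r"
    and good_ex: "v \<in> V \<Longrightarrow> \<exists>\<phi>. good v \<phi>"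
    and good_V: "good v \<phi> \<Longrightarrow> v \<in> V"
    and good_out: "good v \<phi> \<Longrightarrow> c \<in> L v \<Longrightarrow> card {w. (v, w) \<in> E \<and> \<phi> w = c} = r"
    and good_in: "good v \<phi> \<Longrightarrow> c \<in> L v \<Longrightarrow> card {w. (w, v) \<in> E \<and> \<phi> w = c} = r"
    and good_shift: "good v \<phi> \<Longrightarrow> adj v w \<Longrightarrow> good w (\<phi>(v := \<phi> w))"
    and V_nonempty: "V \<noteq> {}"
    and connected: "a \<in> V \<Longrightarrow> b \<in> V \<Longrightarrow> (a, b) \<in> conn V"
begin

text \<open>The \<open>k\<close> colors of \<open>L v\<close> take \<open>r\<close> vertices each
  from the out-neighborhood and from the in-neighborhood, and both have only \<open>k * r\<close>
  elements.\<close>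

lemma color_mem:
  assumes "good v \<phi>" "adj v w"
  shows "\<phi> w \<in> L v"
proof -
  have v: "v \<in> V" by (rule good_V[OF assms(1)])
  have finL: "finite (L v)" using cardL[OF v] k2 by (metis card.infinite not_numeral_le_zero)
  show ?thesis
    using finite_nbrs colors_in_list[of "{w. (v, w) \<in> E}" "L v" r \<phi> w] colors_in_list[of "{w. (w, v) \<in> E}" "L v" r \<phi> w]
      finL cardL[OF v] out_card[OF v] in_card[OF v] good_out[OF assms(1)] good_in[OF assms(1)] assms(2)
    unfolding adj_def by auto
qed

text \<open>Each move of the hole pulls the color of the next vertex back by one place along the
  path.\<close>

lemma shift_path:
  assumes "path (h # p)" "good h \<phi>"
  shows "\<exists>\<phi>'. good (last (h # p)) \<phi>' \<and> map \<phi>' (butlast (h # p)) = map \<phi> p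
      \<and> (\<forall>x. x \<notin> set (h # p) \<longrightarrow> \<phi>' x = \<phi> x)"
  using assms
proof (induction p arbitrary: h \<phi>)
  case Nil
  then show ?case by auto
next
  case (Cons a p)
  from Cons.prems have pth: "path (a # p)" "adj h a" "h \<notin> set (a # p)" by (auto simp: path_Cons)
  then have "good a (\<phi>(h := \<phi> a))" using good_shift Cons.prems(2) by blast
  with Cons.IH[OF pth(1)] obtain \<phi>' where
    \<phi>': "good (last (a # p)) \<phi>'" "map \<phi>' (butlast (a # p)) = map (\<phi>(h := \<phi> a)) p"
      "\<forall>x. x \<notin> set (a # p) \<longrightarrow> \<phi>' x = (\<phi>(h := \<phi> a)) x" by blast
  have "map (\<phi>(h := \<phi> a)) p = map \<phi> p" using pth(3) by auto
  with \<phi>' pth(3) show ?case by (intro exI[of _ \<phi>']) auto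
qed

text \<open>After its passage along \<open>p\<close> the hole returns from \<open>last p\<close>
  straight to \<open>h\<close>; the first color of \<open>p\<close>, parked at \<open>h\<close>,
  thereby moves to the end.\<close>

lemma rotate_colors_1:
  assumes "path p" "h \<notin> set p" "adj h (hd p)" "adj h (last p)" "good h \<phi>"
  shows "\<exists>\<phi>'. good h \<phi>' \<and> map \<phi>' p = rotate1 (map \<phi> p) \<and> (\<forall>x. x \<notin> insert h (set p) \<longrightarrow> \<phi>' x = \<phi> x)"
proof -
  have ne: "p \<noteq> []" using assms(1) by (simp add: path_def)
  have "path (h # p)" using assms by (simp add: path_Cons)
  from shift_path[OF this assms(5)] ne obtain \<psi> where
    \<psi>: "good (last p) \<psi>" "map \<psi> (h # butlast p) = map \<phi> p" "\<forall>x. x \<notin> set (h # p) \<longrightarrow> \<psi> x = \<phi> x"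
    by auto
  let ?\<phi> = "\<psi>(last p := \<psi> h)"
  have "good h ?\<phi>" using good_shift[OF \<psi>(1)] assms(4) adj_sym by blast
  moreover have "map ?\<phi> p = rotate1 (map \<phi> p)"
  proof -
    have "last p \<notin> set (butlast p)"
      using assms(1) append_butlast_last_id[OF ne] unfolding path_def
      by (metis distinct_append disjoint_insert(1) list.simps(15))
    then have "map ?\<phi> (butlast p @ [last p]) = map \<psi> (butlast p) @ [\<psi> h]"
      by auto
    then have "map ?\<phi> p = map \<psi> (butlast p) @ [\<psi> h]" using ne by simp
    also have "\<dots> = rotate1 (map \<psi> (h # butlast p))" by simp
    finally show ?thesis unfolding \<psi>(2) .
  qed
  ultimately show ?thesis using \<psi>(3) ne by (intro exI[of _ ?\<phi>]) auto
qed

lemma rotate_colors: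
  assumes "path p" "h \<notin> set p" "adj h (hd p)" "adj h (last p)" "good h \<phi>"
  shows "\<exists>\<phi>'. good h \<phi>' \<and> map \<phi>' p = rotate s (map \<phi> p) \<and> (\<forall>x. x \<notin> insert h (set p) \<longrightarrow> \<phi>' x = \<phi> x)"
proof (induction s)
  case 0
  then show ?case using assms(5) by auto
next
  case (Suc s)
  then obtain \<phi>1 where \<phi>1: "good h \<phi>1" "map \<phi>1 p = rotate s (map \<phi> p)"
    "\<forall>x. x \<notin> insert h (set p) \<longrightarrow> \<phi>1 x = \<phi> x" by blast
  from rotate_colors_1[OF assms(1-4) \<phi>1(1)] \<phi>1(2,3) show ?case by fastforce
qed

text \<open>The out-neighborhood and the in-neighborhood of \<open>h\<close> are the two instances
  of interest, so one counting argument serves both directions of arcs.\<close>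

definition slice :: "'v set \<Rightarrow> 'v \<Rightarrow> bool" where
  "slice N h \<longleftrightarrow> N \<subseteq> {w. adj h w} \<and> (\<forall>\<phi> c. good h \<phi> \<longrightarrow> c \<in> L h \<longrightarrow> card {w\<in>N. \<phi> w = c} = r)"

lemma slice_out: "slice {w. (h, w) \<in> E} h" and slice_in: "slice {w. (w, h) \<in> E} h"
  using good_out good_in by (auto simp: slice_def adj_def)

text \<open>The total over \<open>N\<close> is \<open>r\<close> for both colorings and the part
  outside \<open>X\<close> is common to them, so the parts inside have equal size.\<close>

lemma slice_card:
  assumes "slice N h" "good h \<phi>" "good h \<phi>'" "\<forall>x. x \<notin> insert h X \<longrightarrow> \<phi>' x = \<phi> x" "c \<in> L h"
  shows "card {w\<in>N \<inter> X. \<phi> w = c} = card {w\<in>N \<inter> X. \<phi>' w = c}"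
proof -
  have N: "N \<subseteq> V" "h \<notin> N" using assms(1) adj_V by (auto simp: slice_def)
  then have fin: "finite N" using finite_V finite_subset by blast
  have split: "card {w\<in>N. \<psi> w = c} = card {w\<in>N \<inter> X. \<psi> w = c} + card {w\<in>N - X. \<psi> w = c}" for \<psi>
  proof -
    have "{w\<in>N. \<psi> w = c} = {w\<in>N \<inter> X. \<psi> w = c} \<union> {w\<in>N - X. \<psi> w = c}" by auto
    then show ?thesis using fin by (simp add: card_Un_disjoint disjoint_iff)
  qed
  have "{w\<in>N - X. \<phi> w = c} = {w\<in>N - X. \<phi>' w = c}" using assms(4) N(2) by (metis (no_types, lifting) Diff_iff insertE)
  moreover have "card {w\<in>N. \<phi> w = c} = card {w\<in>N. \<phi>' w = c}"
    using assms(1-3,5) by (simp add: slice_def)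
  ultimately show ?thesis using split[of \<phi>] split[of \<phi>'] by simp
qed

text \<open>Rotation preserves the color counts on the ends that lie in \<open>N\<close>. If there
  is only one such end, its color is invariant under rotation, so all colors coincide. If there are
  two, they carry the same multiset of colors at positions \<open>s\<close>, \<open>s + 1\<close> as
  at \<open>s + 1\<close>, \<open>s + 2\<close>, which is period two.\<close>

lemma link_slice:
  assumes sl: "slice N h" and ln: "link h p" and gd: "good h \<phi>"
  shows "monochrome \<phi> p \<or> N \<inter> set p = {} \<or> N \<inter> set p = {hd p, last p} \<and> period2 (map \<phi> p)"
proof -
  let ?n = "length p" and ?c = "\<lambda>i. map \<phi> p ! (i mod length p)"
  from ln have p: "path p" "h \<notin> set p" "adj h (hd p)" "adj h (last p)" and n2: "2 \<le> ?n"
    and chord: "\<forall>w\<in>set p. adj h w \<longrightarrow> w = hd p \<or> w = last p" by (auto simp: link_def)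
  have ne: "p \<noteq> []" using n2 by auto
  have hl: "hd p \<noteq> last p" using p(1) n2 by (cases p) (auto simp: path_def)
  have rot: "\<exists>\<phi>'. good h \<phi>' \<and> (\<forall>i<?n. \<phi>' (p ! i) = ?c (s + i)) \<and> (\<forall>x. x \<notin> insert h (set p) \<longrightarrow> \<phi>' x = \<phi> x)" for s
  proof -
    obtain \<phi>' where \<phi>': "good h \<phi>'" "map \<phi>' p = rotate s (map \<phi> p)" "\<forall>x. x \<notin> insert h (set p) \<longrightarrow> \<phi>' x = \<phi> x"
      using rotate_colors[OF p gd] by blast
    have "\<phi>' (p ! i) = ?c (s + i)" if "i < ?n" for i
      using arg_cong[OF \<phi>'(2), of "\<lambda>l. l ! i"] that by (simp add: nth_rotate)
    with \<phi>' show ?thesis by blast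
  qed
  have cmp: "card {w\<in>N \<inter> set p. \<phi>1 w = c} = card {w\<in>N \<inter> set p. \<phi>2 w = c}"
    if "good h \<phi>1" "good h \<phi>2" "\<forall>x. x \<notin> insert h (set p) \<longrightarrow> \<phi>1 x = \<phi> x"
       "\<forall>x. x \<notin> insert h (set p) \<longrightarrow> \<phi>2 x = \<phi> x" "c \<in> L h" for \<phi>1 \<phi>2 c
    by (rule slice_card[OF sl that(1,2) _ that(5)]) (use that(3,4) in auto)
  have const: "monochrome \<phi> p" if *: "\<forall>s. ?c s = ?c (Suc s)"
  proof -
    have "?c (s + 2) = ?c s" for s using spec[OF *, of s] spec[OF *, of "Suc s"] by simp
    then have per: "period2 (map \<phi> p)" unfolding period2_def by simp
    have "?c 0 = ?c (Suc 0)" using * by blast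
    then have "map \<phi> p ! (0 mod length (map \<phi> p)) = map \<phi> p ! (Suc 0 mod length (map \<phi> p))"
      by (simp only: length_map)
    from period2_const[OF per this] show ?thesis unfolding monochrome_map by blast
  qed
  have h0: "hd p = p ! 0" and l0: "last p = p ! (?n - 1)" using ne by (simp_all add: hd_conv_nth last_conv_nth)
  have shift: "(Suc s + (?n - 1)) mod ?n = s mod ?n" for s
  proof -
    have "Suc s + (?n - 1) = s + ?n" using n2 by simp
    then show ?thesis by (metis mod_add_self2)
  qed
  have "N \<inter> set p \<subseteq> {hd p, last p}" using chord sl by (auto simp: slice_def)
  then consider "N \<inter> set p = {}" | "N \<inter> set p = {hd p}" | "N \<inter> set p = {last p}"
    | "N \<inter> set p = {hd p, last p}" by blast
  then show ?thesis
  proof cases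
    case 2
    have "?c s = ?c (Suc s)" for s
    proof -
      obtain \<phi>1 where 1: "good h \<phi>1" "\<forall>i<?n. \<phi>1 (p ! i) = ?c (s + i)" "\<forall>x. x \<notin> insert h (set p) \<longrightarrow> \<phi>1 x = \<phi> x"
        using rot by blast
      obtain \<phi>2 where \<phi>2: "good h \<phi>2" "\<forall>i<?n. \<phi>2 (p ! i) = ?c (Suc s + i)" "\<forall>x. x \<notin> insert h (set p) \<longrightarrow> \<phi>2 x = \<phi> x"
        using rot by blast
      have "card {w\<in>{hd p}. \<phi>1 w = \<phi>1 (hd p)} = card {w\<in>{hd p}. \<phi>2 w = \<phi>1 (hd p)}"
        using cmp[OF 1(1) \<phi>2(1) 1(3) \<phi>2(3) color_mem[OF 1(1) p(3)]] 2 by simp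
      then have "\<phi>2 (hd p) = \<phi>1 (hd p)" by (rule single_color)
      then show ?thesis using 1(2) \<phi>2(2) n2 unfolding h0
        by (metis add_0_right ne length_greater_0_conv)
    qed
    then show ?thesis using const by blast
  next
    case 3
    have "?c s = ?c (Suc s)" for s
    proof -
      \<comment> \<open>With rotation by \<open>Suc s\<close> the last vertex carries the entry
        \<open>Suc s + (?n - 1)\<close>, which is entry \<open>s\<close> modulo
        \<open>?n\<close>.\<close>
      obtain \<phi>1 where 1: "good h \<phi>1" "\<forall>i<?n. \<phi>1 (p ! i) = ?c (Suc s + i)" "\<forall>x. x \<notin> insert h (set p) \<longrightarrow> \<phi>1 x = \<phi> x"
        using rot by blast
      obtain \<phi>2 where \<phi>2: "good h \<phi>2" "\<forall>i<?n. \<phi>2 (p ! i) = ?c (Suc (Suc s) + i)" "\<forall>x. x \<notin> insert h (set p) \<longrightarrow> \<phi>2 x = \<phi> x"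
        using rot by blast
      have "card {w\<in>{last p}. \<phi>1 w = \<phi>1 (last p)} = card {w\<in>{last p}. \<phi>2 w = \<phi>1 (last p)}"
        using cmp[OF 1(1) \<phi>2(1) 1(3) \<phi>2(3) color_mem[OF 1(1) p(4)]] 3 by simp
      then have "\<phi>2 (last p) = \<phi>1 (last p)" by (rule single_color)
      moreover have "\<phi>1 (last p) = ?c s" using 1(2) n2 l0 shift[of s] by simp
      moreover have "\<phi>2 (last p) = ?c (Suc s)" using \<phi>2(2) n2 l0 shift[of "Suc s"] by simp
      ultimately show ?thesis by simp
    qed
    then show ?thesis using const by blast
  next
    case 4
    have "?c (s + 2) = ?c s" for s
    proof -
      obtain \<phi>1 where 1: "good h \<phi>1" "\<forall>i<?n. \<phi>1 (p ! i) = ?c (Suc s + i)" "\<forall>x. x \<notin> insert h (set p) \<longrightarrow> \<phi>1 x = \<phi> x"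
        using rot by blast
      obtain \<phi>2 where \<phi>2: "good h \<phi>2" "\<forall>i<?n. \<phi>2 (p ! i) = ?c (Suc (Suc s) + i)" "\<forall>x. x \<notin> insert h (set p) \<longrightarrow> \<phi>2 x = \<phi> x"
        using rot by blast
      let ?d = "\<phi>1 (last p)"
      have eq: "card {w\<in>{hd p, last p}. \<phi>1 w = ?d} = card {w\<in>{hd p, last p}. \<phi>2 w = ?d}"
        using cmp[OF 1(1) \<phi>2(1) 1(3) \<phi>2(3) color_mem[OF 1(1) p(4)]] 4 by simp
      have l1: "?d = ?c s" using 1(2) n2 l0 shift[of s] by simp
      have l2: "\<phi>2 (last p) = ?c (Suc s)" using \<phi>2(2) n2 l0 shift[of "Suc s"] by simp
      have f1: "\<phi>1 (hd p) = ?c (Suc s)" using 1(2) n2 h0 by (metis add_0_right ne length_greater_0_conv)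
      have f2: "\<phi>2 (hd p) = ?c (s + 2)" using \<phi>2(2) n2 h0 by (metis add_0_right ne length_greater_0_conv add_2_eq_Suc')
      have "\<phi>2 (hd p) = ?d"
      proof (rule ccontr)
        assume "\<phi>2 (hd p) \<noteq> ?d"
        \<comment> \<open>Otherwise an occurrence of \<open>?d\<close> would be lost: under
          \<open>\<phi>1\<close> it sits at \<open>last p\<close>, and also at \<open>hd p\<close>
          if \<open>?c (Suc s) = ?d\<close>; under \<open>\<phi>2\<close> only \<open>last p\<close>
          could carry it, and only in the latter case.\<close>
        then have sub: "{w\<in>{hd p, last p}. \<phi>2 w = ?d} \<subseteq> {w\<in>{last p}. ?c (Suc s) = ?d}"
          using l2 by auto
        have "card {w\<in>{hd p, last p}. \<phi>2 w = ?d} \<le> card {w\<in>{last p}. ?c (Suc s) = ?d}"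
          by (rule card_mono[OF _ sub]) simp
        also have "\<dots> < card {w\<in>{hd p, last p}. \<phi>1 w = ?d}"
        proof (cases "?c (Suc s) = ?d")
          case True
          then have "{w\<in>{hd p, last p}. \<phi>1 w = ?d} = {hd p, last p}" using f1 by auto
          then show ?thesis using True hl by simp
        next
          case False
          have "last p \<in> {w\<in>{hd p, last p}. \<phi>1 w = ?d}" by simp
          then have "card {w\<in>{hd p, last p}. \<phi>1 w = ?d} > 0" by (subst card_gt_0_iff) auto
          then show ?thesis using False by simp
        qed
        finally show False using eq by simp
      qed
      then show ?thesis using f2 l1 by simp
    qed
    then show ?thesis using 4 by (auto simp: period2_def)
  qed simp
qed

lemma link_period2:
  assumes "link h p" "good h \<phi>"
  shows "period2 (map \<phi> p)"
proof -
  have ne: "p \<noteq> []" using assms(1) by (auto simp: link_def)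
  have m: ?thesis if "monochrome \<phi> p"
    by (rule period2_of_const) (use that ne in \<open>simp, unfold monochrome_map, blast\<close>)
  have "adj h (hd p)" using assms(1) by (simp add: link_def)
  then have "hd p \<in> {w. (h, w) \<in> E} \<inter> set p \<or> hd p \<in> {w. (w, h) \<in> E} \<inter> set p"
    using ne by (auto simp: adj_def)
  then show ?thesis
    using link_slice[OF slice_out assms] link_slice[OF slice_in assms] m by blast
qed

text \<open>By \<open>link_slice\<close>, a neighborhood that meets a non-monochrome link contains
  both of its ends; this applies to out-neighbors and in-neighbors separately.\<close>

lemma link_ends_arcs:
  assumes "link h p" "good h \<phi>" "\<not> monochrome \<phi> p"
  shows "(h, hd p) \<in> E \<longleftrightarrow> (h, last p) \<in> E" "(hd p, h) \<in> E \<longleftrightarrow> (last p, h) \<in> E"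
proof -
  have mem: "hd p \<in> set p" "last p \<in> set p" using assms(1) by (auto simp: link_def path_def)
  show "(h, hd p) \<in> E \<longleftrightarrow> (h, last p) \<in> E"
    using link_slice[OF slice_out assms(1,2)] assms(3) mem by blast
  show "(hd p, h) \<in> E \<longleftrightarrow> (last p, h) \<in> E"
    using link_slice[OF slice_in assms(1,2)] assms(3) mem by blast
qed

lemma link_V:
  assumes "link h p"
  shows "set p \<subseteq> V"
proof
  fix x assume "x \<in> set p"
  then obtain i where i: "i < length p" "x = p ! i" by (auto simp: in_set_conv_nth)
  show "x \<in> V"
  proof (cases i)
    case 0
    then have "x = hd p" using i by (simp add: hd_conv_nth)
    then show ?thesis using assms adj_V by (auto simp: link_def)
  next
    case (Suc j)
    then have "adj (p ! j) x" using assms i by (auto simp: link_def path_def successively_conv_nth)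
    then show ?thesis using adj_V by blast
  qed
qed

lemma link_even:
  assumes "link h p" "good h \<phi>" "\<not> monochrome \<phi> p"
  shows "even (length p)"
proof (rule ccontr)
  assume "odd (length p)"
  then have "odd (length (map \<phi> p))" by simp
  from period2_odd_const[OF link_period2[OF assms(1,2)] this] show False
    using assms(3) unfolding monochrome_map by blast
qed

lemma link_ends_differ:
  assumes "link h p" "good h \<phi>" "\<not> monochrome \<phi> p"
  shows "\<phi> (hd p) \<noteq> \<phi> (last p)"
proof
  assume eq: "\<phi> (hd p) = \<phi> (last p)"
  have ne: "map \<phi> p \<noteq> []" using assms(1) by (auto simp: link_def)
  then have "hd (map \<phi> p) = last (map \<phi> p)" using eq by (simp add: hd_map last_map)
  from period2_ends_const[OF link_period2[OF assms(1,2)] ne this] show False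
    using assms(3) unfolding monochrome_map by blast
qed

text \<open>Rotating along the whole path brings any three cyclically consecutive entries to the
  first three places of \<open>W\<close>, where the first and third agree because \<open>W\<close>
  is a link. The prefix \<open>us\<close> may contain further neighbors of \<open>h\<close>.\<close>

lemma window_period2:
  assumes "path (us @ W)" "h \<notin> set us" "adj h (hd (us @ W))" "link h W" "3 \<le> length W" "good h \<phi>"
  shows "period2 (map \<phi> (us @ W))"
  unfolding period2_def
proof
  fix i
  let ?p = "us @ W" and ?a = "length us"
  let ?n = "length ?p"
  \<comment> \<open>The rotation is chosen such that entry \<open>i\<close> lands on the first
    vertex of \<open>W\<close>, at index \<open>?a\<close>.\<close>
  obtain s where s: "(s + ?a) mod ?n = i mod ?n"
  proof
    show "((i + (?n - ?a)) + ?a) mod ?n = i mod ?n"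
    proof -
      have "(i + (?n - ?a)) + ?a = i + ?n" by simp
      then show ?thesis by (metis mod_add_self2)
    qed
  qed
  have p: "path ?p" "h \<notin> set ?p" "adj h (hd ?p)" "adj h (last ?p)"
    using assms by (auto simp: link_def path_def)
  obtain \<phi>' where \<phi>': "good h \<phi>'" "map \<phi>' ?p = rotate s (map \<phi> ?p)"
    using rotate_colors[OF p assms(6)] by blast
  have nth: "\<phi>' (?p ! j) = map \<phi> ?p ! ((s + j) mod ?n)" if "j < ?n" for j
    using arg_cong[OF \<phi>'(2), of "\<lambda>l. l ! j"] that by (simp add: nth_rotate del: map_append)
  \<comment> \<open>Since \<open>W\<close> has at least three vertices, index 2 does not wrap around
    inside \<open>W\<close>.\<close>
  have "map \<phi>' W ! ((0 + 2) mod length W) = map \<phi>' W ! (0 mod length W)"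
    using link_period2[OF assms(4) \<phi>'(1)] by (simp only: period2_def length_map)
  then have "\<phi>' (W ! 2) = \<phi>' (W ! 0)" using assms(5)
    by (cases W) (auto simp: numeral_2_eq_2)
  then have eq: "\<phi>' (?p ! (?a + 2)) = \<phi>' (?p ! ?a)" using assms(5) by (simp add: nth_append)
  have l: "?a + 2 < ?n" "?a < ?n" using assms(5) by auto
  from eq have "map \<phi> ?p ! ((s + (?a + 2)) mod ?n) = map \<phi> ?p ! ((s + ?a) mod ?n)"
    unfolding nth[OF l(1)] nth[OF l(2)] .
  moreover have "(s + (?a + 2)) mod ?n = (i + 2) mod ?n"
    using s by (metis add.assoc mod_add_left_eq)
  ultimately show "map \<phi> ?p ! ((i + 2) mod length (map \<phi> ?p)) = map \<phi> ?p ! (i mod length (map \<phi> ?p))"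
    using s by simp
qed

section \<open>Links of at least three vertices at a noncut vertex\<close>

lemma other_color:
  assumes "good v \<phi>"
  shows "\<exists>b. adj v b \<and> \<phi> b \<noteq> c"
proof -
  have v: "v \<in> V" by (rule good_V[OF assms])
  have "\<not> L v \<subseteq> {c}"
  proof
    assume "L v \<subseteq> {c}"
    then have "card (L v) \<le> card {c}" by (rule card_mono[rotated]) simp
    then show False using cardL[OF v] k2 by simp
  qed
  then obtain d where d: "d \<in> L v" "d \<noteq> c" by auto
  have "{w. (v, w) \<in> E \<and> \<phi> w = d} \<noteq> {}"
    using good_out[OF assms d(1)] r1 by (metis (no_types, lifting) card.empty not_one_le_zero)
  with d(2) show ?thesis by (auto simp: adj_def)
qed

definition noncut :: "'v \<Rightarrow> bool" where
  "noncut v \<longleftrightarrow> (\<forall>a\<in>V - {v}. \<forall>b\<in>V - {v}. (a, b) \<in> conn (V - {v}))"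

text \<open>As deleting \<open>v\<close> leaves a connected graph, some path \<open>us\<close> from
  the extra neighbor \<open>b\<close> reaches \<open>W\<close> at a vertex \<open>s\<close>. Its
  part from \<open>b'\<close>, the last neighbor of \<open>v\<close> on it, is a leg that can be
  closed to new links.\<close>

lemma approach:
  assumes "noncut v" "adj v b" "b \<notin> set W" "path W" "v \<notin> set W" "set W \<subseteq> V"
  obtains us us1 b' us2 w1 s w2 where "path us" "hd us = b" "set us \<inter> set W = {}" "v \<notin> set us"
    "W = w1 @ s # w2" "adj (last us) s" "us = us1 @ b' # us2" "adj v b'" "\<forall>z\<in>set us2. \<not> adj v z"
proof -
  have b: "b \<in> V - {v}" using assms(2) adj_V by auto
  have W: "hd W \<in> V - {v}" "hd W \<in> set W" using assms(4-6) by (auto simp: path_def)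
  have "(b, hd W) \<in> conn (V - {v})" using assms(1) b W by (auto simp: noncut_def)
  from first_hit[OF this b assms(3) W(2)] obtain s t where
    st: "(b, t) \<in> conn (V - {v} - set W)" "s \<in> set W" "adj t s" by metis
  from conn_path[OF st(1)] b assms(3) obtain us where
    us: "path us" "hd us = b" "last us = t" "set us \<subseteq> V - {v} - set W" by auto
  have "b \<in> set us" using us(1,2) by (auto simp: path_def)
  then have "\<exists>z\<in>set us. adj v z" using assms(2) by blast
  from split_list_last_prop[OF this] obtain us1 b' us2 where
    "us = us1 @ b' # us2" "adj v b'" "\<forall>z\<in>set us2. \<not> adj v z" by blast
  moreover obtain w1 w2 where "W = w1 @ s # w2" using st(2) by (auto simp: in_set_conv_decomp)
  ultimately show thesis using that us st(3) by blast
qed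

text \<open>The leg \<open>b' # us2\<close> replaces the part of the link before \<open>s\<close>.
  Being an inner vertex, \<open>s\<close> is not adjacent to \<open>v\<close>, so \<open>v\<close>
  sees only the two new ends.\<close>

lemma link_branch:
  assumes "link v (w1 @ s # w2)" "w1 \<noteq> []" "w2 \<noteq> []" "path us" "set us \<inter> set (w1 @ s # w2) = {}"
    "v \<notin> set us" "adj (last us) s" "us = us1 @ b' # us2" "adj v b'" "\<forall>z\<in>set us2. \<not> adj v z"
  shows "link v (b' # us2 @ s # w2)"
proof -
  from assms(1) have W: "path (w1 @ s # w2)" "v \<notin> set (w1 @ s # w2)" "adj v (last (s # w2))"
    "\<forall>w\<in>set (w1 @ s # w2). adj v w \<longrightarrow> w = hd w1 \<or> w = last w2" using assms(2,3) by (auto simp: link_def)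
  have p1: "path (s # w2)" using W(1) by (auto simp: path_append split: if_splits)
  have p2: "path (b' # us2)" using assms(4,8) by (auto simp: path_append split: if_splits)
  have "hd w1 \<notin> set (s # w2)" "s \<notin> set w2"
    using W(1) assms(2) by (auto simp: path_def dest: hd_in_set)
  then have "s \<noteq> hd w1" "s \<noteq> last w2" "\<forall>w\<in>set w2. w \<noteq> hd w1" using assms(3) by (auto dest: last_in_set)
  then have "\<not> adj v s" "\<forall>w\<in>set w2. adj v w \<longrightarrow> w = last w2" using W(4) by auto
  moreover have "path (b' # us2 @ s # w2)"
    using p1 p2 assms(5,7,8) path_append[of "b' # us2" "s # w2"] by auto
  ultimately show ?thesis using assms(3,6,8-10) W(2,3) by (auto simp: link_def)
qed

text \<open>
  A neighbor b of another color would be joined to the link by a path. Rotating the colors along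
  that path and the link makes the color of b appear inside the link.
\<close>

lemma long_link_not_monochrome:
  assumes "noncut v" "link v W" "3 \<le> length W" "good v \<phi>"
  shows "\<not> monochrome \<phi> W"
proof
  assume mono: "monochrome \<phi> W"
  obtain b where b: "adj v b" "\<phi> b \<noteq> \<phi> (hd W)" using other_color[OF assms(4)] by blast
  have W: "path W" "v \<notin> set W" "W \<noteq> []" using assms(2) by (auto simp: link_def path_def)
  have hdW: "hd W \<in> set W" using W(3) by simp
  have bW: "b \<notin> set W" using mono b(2) hdW unfolding monochrome_def by blast
  have WV: "set W \<subseteq> V" by (rule link_V[OF assms(2)])
  obtain us us1 b' us2 w1 s w2 where us: "path us" "hd us = b" "set us \<inter> set W = {}" "v \<notin> set us"
    "W = w1 @ s # w2" "adj (last us) s" "us = us1 @ b' # us2" "adj v b'" "\<forall>z\<in>set us2. \<not> adj v z"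
    using approach[OF assms(1) b(1) bW W(1,2) WV] .
  \<comment> \<open>Stated for a splitting of \<open>W\<close> or of its reverse, so that
    \<open>s\<close> is not the last vertex.\<close>
  have key: False if X: "link v (x1 @ s # x2)" "x2 \<noteq> []" "3 \<le> length (x1 @ s # x2)"
    "set (x1 @ s # x2) = set W" for x1 x2
  proof -
    obtain a x3 where x2: "x2 = a # x3" using X(2) by (cases x2) auto
    have ne: "us \<noteq> []" using us(1) by (simp add: path_def)
    have pX: "path (s # x2)" using X(1) by (auto simp: link_def path_append split: if_splits)
    have "set us \<inter> set (s # x2) = {}" using us(3) X(4) by auto
    then have pth: "path (us @ s # x2)" using us(1,6) pX ne by (simp add: path_append)
    have per: "period2 (map \<phi> (us @ s # x2))"
    proof (cases "x1 = []")
      case True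
      then show ?thesis using window_period2[OF pth us(4) _ _ _ assms(4)] X b(1) us(2) ne by simp
    next
      case False
      \<comment> \<open>For an inner vertex \<open>s\<close> the branch through \<open>b'\<close> is
        the link that serves as the window, with \<open>us1\<close> in front of it.\<close>
      have l: "link v (b' # us2 @ s # x2)"
        using link_branch[OF X(1) False X(2) us(1) _ us(4,6-9)] us(3) X(4) by blast
      have e: "us @ s # x2 = us1 @ (b' # us2 @ s # x2)" using us(7) by simp
      have "h \<notin> set us1" if "h \<notin> set us" for h using that us(7) by auto
      then show ?thesis unfolding e
        by (intro window_period2[OF _ _ _ l _ assms(4)])
           (use pth e us(2,4) b(1) ne x2 in \<open>auto simp: hd_append split: if_splits\<close>)
    qed
    have sW: "s \<in> set W" "a \<in> set W" using X(4) x2 by auto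
    \<comment> \<open>Two consecutive vertices of the same color make a sequence of period two
      constant, which transports that color to \<open>b\<close>.\<close>
    then have "\<phi> s = \<phi> a" using mono unfolding monochrome_def by blast
    then have "\<phi> b = \<phi> s"
      using period2_consec_const[of "map \<phi> us" "\<phi> s" "\<phi> a" "map \<phi> x3" "\<phi> b" "\<phi> s"] per us(2) ne x2
      by (auto intro: hd_in_set)
    moreover have "\<phi> s = \<phi> (hd W)" using mono sW hdW unfolding monochrome_def by blast
    ultimately show False using b(2) by simp
  qed
  show False
  proof (cases "w2 = []")
    case False
    then show ?thesis using key[of w1 w2] assms(2,3) us(5) by auto
  next
    case True
    then have "rev W = [] @ s # rev w1" "w1 \<noteq> []" using us(5) assms(3) by auto
    then show ?thesis using key[of "[]" "rev w1"] link_rev[OF assms(2)] assms(3)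
      by (metis append_Nil length_rev rev_is_Nil_conv set_rev)
  qed
qed

text \<open>
  Otherwise a further neighbor is joined to a vertex s of the link. If s is an inner vertex, three
  links of even order arise from three legs at s, which is impossible by parity. If s is an end,
  a path of even order is cut into two links of even order that share s.
\<close>

lemma long_link_ends:
  assumes "noncut v" "link v W" "3 \<le> length W" "adj v b"
  shows "b = hd W \<or> b = last W"
proof (rule ccontr)
  assume nb: "\<not> ?thesis"
  have W: "path W" "v \<notin> set W" "W \<noteq> []" using assms(2) by (auto simp: link_def path_def)
  have bW: "b \<notin> set W" using assms(2,4) nb by (auto simp: link_def)
  have WV: "set W \<subseteq> V" by (rule link_V[OF assms(2)])
  obtain \<phi> where \<phi>: "good v \<phi>" using good_ex assms(4) adj_V by blast
  have ev: "even (length Z)" if "link v Z" "3 \<le> length Z" for Z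
    using link_even[OF that(1) \<phi> long_link_not_monochrome[OF assms(1) that \<phi>]] .
  obtain us us1 b' us2 w1 s w2 where us: "path us" "hd us = b" "set us \<inter> set W = {}" "v \<notin> set us"
    "W = w1 @ s # w2" "adj (last us) s" "us = us1 @ b' # us2" "adj v b'" "\<forall>z\<in>set us2. \<not> adj v z"
    using approach[OF assms(1,4) bW W(1,2) WV] .
  have p2: "path (b' # us2)" using us(1,7) by (auto simp: path_append split: if_splits)
  have key: False if X: "link v (s # x)" "x \<noteq> []" "3 \<le> length (s # x)" "set (s # x) = set W" for x
  proof -
    have p3: "path (b' # us2 @ s # x)"
      using p2 X(1,4) us(3,6,7) path_append[of "b' # us2" "s # x"] by (auto simp: link_def)
    have "adj v (hd (b' # us2 @ s # x))" using us(8) by simp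
    then have "period2 (map \<phi> ((b' # us2) @ s # x))"
      using window_period2[of "b' # us2" "s # x" v \<phi>] p3 us(4,7) X \<phi> by auto
    moreover
    have "\<not> monochrome \<phi> (s # x)"
      using long_link_not_monochrome[OF assms(1) X(1,3) \<phi>] .
    then have "\<not> monochrome \<phi> ((b' # us2) @ s # x)"
      unfolding monochrome_def set_append by blast
    ultimately have "even (length (map \<phi> ((b' # us2) @ s # x)))"
      using period2_odd_const[of "map \<phi> ((b' # us2) @ s # x)"] unfolding monochrome_map by blast
    with ev[OF X(1,3)] have e: "even (length (b' # us2))" by auto
    moreover have "link v (b' # us2 @ [s])"
      using p2 X(1,4) us path_append[of "b' # us2" "[s]"]
      by (auto simp: link_def) (auto simp: path_def)
    \<comment> \<open>An even leg has at least two vertices, so adding \<open>s\<close> yields a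
      link with at least three vertices and odd order.\<close>
    ultimately show False using ev[of "b' # us2 @ [s]"] by (cases us2) auto
  qed
  consider "w1 = []" | "w2 = []" | "w1 \<noteq> []" "w2 \<noteq> []" by blast
  then show False
  proof cases
    case 1
    then show ?thesis using key[of w2] assms(2,3) us(5) by (cases w2) auto
  next
    case 2
    then have "rev W = s # rev w1" "w1 \<noteq> []" using us(5) assms(3) by auto
    then show ?thesis using key[of "rev w1"] link_rev[OF assms(2)] assms(3)
      by (metis length_rev rev_is_Nil_conv set_rev)
  next
    case 3
    have l1: "link v (b' # us2 @ s # w2)"
      using link_branch[OF _ 3 us(1) _ us(4,6-9)] assms(2) us(3,5) by auto
    have "rev W = rev w2 @ s # rev w1" using us(5) by simp
    then have "link v (rev w2 @ s # rev w1)" using link_rev[OF assms(2)] by simp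
    then have l2: "link v (b' # us2 @ s # rev w1)"
      using link_branch[of v "rev w2" s "rev w1" us us1 b' us2] 3 us by auto
    have "even (length w1 + 1 + length w2)" using ev[OF assms(2,3)] us(5) by simp
    moreover have "even (length us2 + length w2)" using ev[OF l1] 3 by (cases w2) auto
    moreover have "even (length us2 + length w1)" using ev[OF l2] 3 by (cases w1) auto
    ultimately show False by presburger
  qed
qed

text \<open>Each vertex of the cycle can be made the hole, and its arcs to the two cycle neighbors
  then have the same directions. Going around, forward arcs at one step match backward arcs at the
  next, and the odd length makes both present everywhere.\<close>

lemma cycle_digons:
  assumes cyc: "induced_cycle cs" and gd: "good (hd cs) \<phi>" and nm: "\<not> monochrome \<phi> (tl cs)"
  shows "odd (length cs)"
    and "\<And>i j. i < length cs \<Longrightarrow> j < length cs \<Longrightarrow>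
           (cs ! i, cs ! j) \<in> E \<longleftrightarrow> j = Suc i mod length cs \<or> i = Suc j mod length cs"
proof -
  let ?n = "length cs"
  have n3: "3 \<le> ?n" using cyc by (simp add: induced_cycle_def)
  have ne: "rotate s cs \<noteq> []" for s using n3 by auto
  define f where "f i = cs ! (i mod ?n)" for i
  have fn: "f (i + ?n) = f i" for i by (simp add: f_def)
  have nthr: "rotate s cs ! i = f (s + i)" if "i < ?n" for s i
    using that by (simp add: nth_rotate f_def)
  have hdr: "hd (rotate s cs) = f s" for s
    using nthr[of 0 s] n3 ne by (simp add: hd_conv_nth)
  have lk: "link (f s) (tl (rotate s cs))" for s
  proof -
    have "rotate s cs = f s # tl (rotate s cs)" using ne hdr by (metis list.collapse)
    then show ?thesis using induced_cycle_link induced_cycle_rotate[OF cyc, of s] by metis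
  qed
  have hd2: "hd (tl (rotate s cs)) = f (Suc s)" for s
  proof -
    have "tl (rotate s cs) \<noteq> []" by (rule link_nonempty[OF lk])
    then have "hd (tl (rotate s cs)) = hd (rotate1 (rotate s cs))"
      using ne[of s] by (cases "rotate s cs") auto
    also have "\<dots> = f (Suc s)" using hdr[of "Suc s"] by (simp only: rotate_Suc)
    finally show ?thesis .
  qed
  have last2: "last (tl (rotate s cs)) = f (s + (?n - 1))" for s
  proof -
    have "tl (rotate s cs) \<noteq> []" by (rule link_nonempty[OF lk])
    then have "last (tl (rotate s cs)) = last (rotate s cs)" by (simp add: last_tl)
    also have "\<dots> = rotate s cs ! (length (rotate s cs) - 1)"
      by (rule last_conv_nth[OF ne])
    also have "\<dots> = f (s + (?n - 1))"
      unfolding length_rotate by (rule nthr) (use n3 in linarith)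
    finally show ?thesis .
  qed
  \<comment> \<open>Moving the hole to the next vertex puts the color of that vertex on the old
    hole, so the rest of the cycle keeps its set of colors.\<close>
  have goods: "\<exists>\<psi>. good (f s) \<psi> \<and> \<not> monochrome \<psi> (tl (rotate s cs))" for s
  proof (induction s)
    case 0
    show ?case using gd nm hdr[of 0] by auto
  next
    case (Suc s)
    then obtain \<psi> where \<psi>: "good (f s) \<psi>" "\<not> monochrome \<psi> (tl (rotate s cs))" by blast
    obtain a q where aq: "tl (rotate s cs) = a # q" using link_nonempty[OF lk[of s]] by (meson list.exhaust)
    then have rs: "rotate s cs = f s # a # q" using ne hdr by (metis list.collapse)
    then have rs': "rotate (Suc s) cs = a # q @ [f s]" by simp
    have a: "a = f (Suc s)" using hdr[of "Suc s"] rs' by simp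
    let ?\<psi> = "\<psi>(f s := \<psi> a)"
    have adj: "adj (f s) a" and fs: "f s \<notin> set (a # q)" using lk[of s] aq by (auto simp: link_def)
    have "map ?\<psi> (q @ [f s]) = map \<psi> q @ [\<psi> a]" using fs by auto
    then have "set (map ?\<psi> (q @ [f s])) = set (map \<psi> (a # q))" by (metis list.simps(9) rotate1.simps(2) set_rotate1)
    then have "\<not> monochrome ?\<psi> (q @ [f s])" using \<psi>(2) unfolding aq monochrome_map by metis
    moreover have "good (f (Suc s)) ?\<psi>" using good_shift[OF \<psi>(1) adj] unfolding a .
    moreover have "tl (rotate (Suc s) cs) = q @ [f s]" unfolding rs' by (simp only: append_Cons list.sel)
    ultimately show ?case by (intro exI[of _ ?\<psi>]) (simp only: simp_thms)
  qed
  obtain \<psi> where \<psi>: "good (f 0) \<psi>" "\<not> monochrome \<psi> (tl (rotate 0 cs))" using goods by blast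
  have "even (length (tl (rotate 0 cs)))" using link_even[OF lk \<psi>] .
  then show odd: "odd ?n" using n3 by auto
  define F where "F s \<longleftrightarrow> (f s, f (Suc s)) \<in> E" for s
  define G where "G s \<longleftrightarrow> (f (Suc s), f s) \<in> E" for s
  have eq: "(f s, f (Suc s)) \<in> E \<longleftrightarrow> (f s, f (s + (?n - 1))) \<in> E"
    "(f (Suc s), f s) \<in> E \<longleftrightarrow> (f (s + (?n - 1)), f s) \<in> E" for s
    using goods[of s] link_ends_arcs[OF lk[of s]] hd2[of s] last2[of s] by auto
  have prev: "f (Suc s + (?n - 1)) = f s" for s
    using fn[of s] n3 by (metis add.assoc add_Suc_shift Suc_diff_1 add.commute plus_1_eq_Suc less_le_trans zero_less_numeral)
  have FG: "F (Suc s) \<longleftrightarrow> G s" "G (Suc s) \<longleftrightarrow> F s" for s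
    using eq[of "Suc s"] prev[of s] by (simp_all add: F_def G_def)
  have F2: "F (s + 2 * j) \<longleftrightarrow> F s" for s j
    by (induction j) (use FG in auto)
  \<comment> \<open>On an odd cycle \<open>?n + 1\<close> is even, so the double steps of
    \<open>F2\<close> also link neighboring indices.\<close>
  have F1: "F (Suc s) \<longleftrightarrow> F s" for s
  proof -
    have "F (Suc s) \<longleftrightarrow> F (Suc s + ?n)" using fn[of "Suc s"] fn[of "Suc (Suc s)"] by (simp add: F_def)
    moreover obtain m where "?n = 2 * m + 1" using odd by (elim oddE)
    ultimately show ?thesis using F2[of s "Suc m"] by simp
  qed
  have F0: "F s \<longleftrightarrow> F 0" for s by (induction s) (use F1 in auto)
  have "adj (f 0) (f 1)"
    using lk[of 0] hd2[of 0] by (simp add: link_def)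
  then have "F 0 \<or> G 0" by (simp add: F_def G_def adj_def)
  then have all: "F s" "G s" for s using F0 FG by auto
  have dig: "(cs ! i, cs ! (Suc i mod ?n)) \<in> E" "(cs ! (Suc i mod ?n), cs ! i) \<in> E" if "i < ?n" for i
    using all[of i] that by (simp_all add: F_def G_def f_def)
  fix i j assume ij: "i < ?n" "j < ?n"
  have "(cs ! i, cs ! j) \<in> E \<Longrightarrow> j = Suc i mod ?n \<or> i = Suc j mod ?n"
    using cyc ij unfolding induced_cycle_def adj_def by blast
  then show "(cs ! i, cs ! j) \<in> E \<longleftrightarrow> j = Suc i mod ?n \<or> i = Suc j mod ?n"
    using dig ij by blast
qed

section \<open>The odd cycle from a shortest link\<close>

lemma two_nbrs:
  assumes "k * r = 2" "v \<in> V" "a \<noteq> b" "(v, a) \<in> E" "(v, b) \<in> E" "(a, v) \<in> E" "(b, v) \<in> E" "adj v w"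
  shows "w = a \<or> w = b"
proof -
  have "{a, b} = {w. (v, w) \<in> E}"
    by (rule card_subset_eq) (use finite_nbrs out_card[OF assms(2)] assms in auto)
  moreover have "{a, b} = {w. (w, v) \<in> E}"
    by (rule card_subset_eq) (use finite_nbrs in_card[OF assms(2)] assms in auto)
  ultimately show ?thesis using assms(8) unfolding adj_def by blast
qed

text \<open>Replacing the stretch from \<open>i\<close> to \<open>j\<close> by the chord keeps both
  ends. The last hypothesis excludes the chord between the ends, which would leave just two
  vertices.\<close>

lemma long_link_shortcut:
  assumes "link v W" "i < j" "j < length W" "adj (W ! i) (W ! j)" "j \<noteq> Suc i"
    "i \<noteq> 0 \<or> Suc j \<noteq> length W"
  shows "\<exists>W'. link v W' \<and> 3 \<le> length W' \<and> length W' < length W"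
proof -
  let ?A = "take (Suc i) W" and ?B = "drop j W"
  have W: "path W" "v \<notin> set W" using assms(1) by (auto simp: link_def)
  have ne: "W \<noteq> []" "?A \<noteq> []" "?B \<noteq> []" using assms(3) by auto
  have pA: "path ?A" "set ?A \<inter> set (drop (Suc i) W) = {}"
    using path_append[of ?A "drop (Suc i) W"] W(1) ne assms(2,3) by simp_all
  have pB: "path ?B" using path_append[of "take j W" ?B] W(1) ne by (simp split: if_splits)
  have "set ?B \<subseteq> set (drop (Suc i) W)" using assms(2) by (intro set_drop_subset_set_drop) auto
  then have dis: "set ?A \<inter> set ?B = {}" using pA(2) by blast
  have "last ?A = W ! i" using assms(2,3) ne by (simp add: last_conv_nth min_def)
  moreover have "hd ?B = W ! j" using assms(3) by (simp add: hd_drop_conv_nth)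
  ultimately have p: "path (?A @ ?B)" using pA(1) pB dis assms(4) ne by (simp add: path_append)
  have hl: "hd (?A @ ?B) = hd W" "last (?A @ ?B) = last W" using ne assms(3) by (simp_all add: last_drop)
  have sub: "set (?A @ ?B) \<subseteq> set W" using set_take_subset[of "Suc i" W] set_drop_subset[of j W] by auto
  have len: "length (?A @ ?B) = Suc i + (length W - j)" using assms(2,3) by simp
  have "link v (?A @ ?B)"
    using assms(1) p hl sub len unfolding link_def using assms(2,3) by (auto simp del: length_append)
  moreover have "3 \<le> length (?A @ ?B)" "length (?A @ ?B) < length W"
    unfolding len using assms(2,3,5,6) by auto
  ultimately show ?thesis by blast
qed

text \<open>The digons to its two cycle neighbors use up both degrees of a vertex, so no arc leaves
  or enters the cycle and connectedness finishes.\<close>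

lemma digon_cycle_spanning:
  assumes kr: "k * r = 2" and cyc: "induced_cycle cs" and sub: "set cs \<subseteq> V"
    and dig: "\<And>i j. i < length cs \<Longrightarrow> j < length cs \<Longrightarrow>
           (cs ! i, cs ! j) \<in> E \<longleftrightarrow> j = Suc i mod length cs \<or> i = Suc j mod length cs"
  shows "set cs = V"
proof (rule closed_eq_V[OF connected sub])
  show "set cs \<noteq> {}" using cyc by (auto simp: induced_cycle_def)
  fix a w assume a: "a \<in> set cs" "adj a w"
  obtain i where i: "i < length cs" "a = cs ! i" using a(1) by (metis in_set_conv_nth)
  have "3 \<le> length cs" using cyc by (simp add: induced_cycle_def)
  from cyclic_neighbours[OF this i(1)] obtain j l where
    jl: "j < length cs" "l < length cs" "j \<noteq> l" "j = Suc i mod length cs" "i = Suc l mod length cs" .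
  have ne: "cs ! j \<noteq> cs ! l" using cyc jl(1-3) by (simp add: induced_cycle_def nth_eq_iff_index_eq)
  have E: "(cs ! i, cs ! j) \<in> E" "(cs ! i, cs ! l) \<in> E" "(cs ! j, cs ! i) \<in> E" "(cs ! l, cs ! i) \<in> E"
    using dig[OF i(1) jl(1)] dig[OF i(1) jl(2)] dig[OF jl(1) i(1)] dig[OF jl(2) i(1)] jl(4,5) by blast+
  have "cs ! i \<in> V" using sub i(1) nth_mem by blast
  then have "w = cs ! j \<or> w = cs ! l"
    using two_nbrs[OF kr _ ne E] a(2) i(2) by blast
  then show "w \<in> set cs" using jl(1,2) by auto
qed

lemma long_link_odd_cycle:
  assumes nc: "noncut v" and "link v W0" "3 \<le> length W0"
  shows "k = 2 \<and> r = 1 \<and> (\<exists>cs. 3 \<le> length cs \<and> odd (length cs) \<and> distinct cs \<and> set cs = V \<and>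
      (\<forall>i<length cs. \<forall>j<length cs.
         (cs ! i, cs ! j) \<in> E \<longleftrightarrow> j = Suc i mod length cs \<or> i = Suc j mod length cs))"
proof -
  obtain W where W: "link v W" "3 \<le> length W"
    and least: "\<forall>W'. link v W' \<and> 3 \<le> length W' \<longrightarrow> length W \<le> length W'"
    using ex_has_least_nat[of "\<lambda>W. link v W \<and> 3 \<le> length W" W0 length] assms by blast
  let ?x = "hd W" and ?y = "last W"
  have ends: "b = ?x \<or> b = ?y" if "adj v b" for b using long_link_ends[OF nc W that] .
  have Wp: "path W" "v \<notin> set W" "adj v ?x" "adj v ?y" "W \<noteq> []" using W by (auto simp: link_def)
  then have v: "v \<in> V" using adj_V by blast
  have xW: "?x \<in> set W" "?y \<in> set W" using Wp(5) by auto
  have xV: "?x \<in> V" "?y \<in> V" using Wp adj_V by auto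
  obtain \<phi> where \<phi>: "good v \<phi>" using good_ex[OF v] by blast
  have nm: "\<not> monochrome \<phi> W" using long_link_not_monochrome[OF nc W \<phi>] .
  have xy: "\<phi> ?x \<noteq> \<phi> ?y" using link_ends_differ[OF W(1) \<phi> nm] .
  \<comment> \<open>All neighbors of \<open>v\<close> are ends of the link, which bounds the degree
    \<open>k * r\<close> by 2.\<close>
  have "card {w. (v, w) \<in> E} \<le> card {?x, ?y}"
    by (rule card_mono) (use ends in \<open>auto simp: adj_def\<close>)
  also have "\<dots> \<le> 2" by (simp add: card_insert_if)
  finally have "k * r \<le> 2" using out_card[OF v] by simp
  then have k: "k = 2" and r: "r = 1"
  proof -
    assume a: "k * r \<le> 2"
    have "k * 1 \<le> k * r" "2 * r \<le> k * r" using k2 r1 by (intro mult_le_mono; simp)+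
    then have "k \<le> 2" "r \<le> 1" using a by linarith+
    with k2 r1 show "k = 2" "r = 1" by linarith+
  qed
  then have kr: "k * r = 2" by simp
  \<comment> \<open>Adjacent ends would form a triangle of digons with \<open>v\<close>. This
    exhausts the degree of \<open>?x\<close> and leaves no room for its successor
    \<open>W ! 1\<close> on the link.\<close>
  have nxy: "\<not> adj ?x ?y"
  proof
    assume a: "adj ?x ?y"
    have d: "v \<noteq> ?x" "v \<noteq> ?y" "?x \<noteq> ?y" using Wp(2) xW xy by auto
    have cyc: "induced_cycle [v, ?x, ?y]"
      by (rule induced_triangle) (use a Wp(3,4) d adj_sym in \<open>blast | simp\<close>)+
    have "\<not> monochrome \<phi> (tl [v, ?x, ?y])" using xy by (auto simp: monochrome_def)
    note dig = cycle_digons(2)[OF cyc _ this, simplified, OF \<phi>]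
    have E: "(?x, v) \<in> E" "(v, ?x) \<in> E" "(?x, ?y) \<in> E" "(?y, ?x) \<in> E"
      using dig[of 1 0] dig[of 0 1] dig[of 1 2] dig[of 2 1] by auto
    have q: "adj ?x (W ! 1)" using Wp(1,5) W(2)
      by (auto simp: path_def successively_conv_nth hd_conv_nth)
    have "W ! 1 = v \<or> W ! 1 = ?y"
      by (rule two_nbrs[OF kr xV(1)]) (use E q d in auto)
    moreover have "W ! 1 \<in> set W" using W(2) by simp
    moreover have "W ! 1 \<noteq> ?y"
      using Wp(1,5) W(2) by (auto simp: path_def last_conv_nth nth_eq_iff_index_eq)
    ultimately show False using Wp(2) by auto
  qed
  have chord: "j = Suc i" if "i < j" "j < length W" "adj (W ! i) (W ! j)" for i j
  proof (rule ccontr)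
    assume ne: "j \<noteq> Suc i"
    have "i \<noteq> 0 \<or> Suc j \<noteq> length W"
    proof (rule ccontr)
      assume "\<not> ?thesis"
      then have "i = 0" "j = length W - 1" by auto
      then show False using that(3) nxy Wp(5) by (simp add: hd_conv_nth last_conv_nth)
    qed
    from long_link_shortcut[OF W(1) that ne this] least show False by (meson not_le)
  qed
  let ?cs = "v # W"
  let ?n = "length ?cs"
  have cyc: "induced_cycle ?cs"
  proof -
    have step: "adj (?cs ! i) (?cs ! j) \<longleftrightarrow> j = Suc i mod ?n \<or> i = Suc j mod ?n"
      if ij: "i < j" "j < ?n" for i j
    proof (cases i)
      case 0
      obtain l where l: "j = Suc l" "l < length W" using ij by (cases j) auto
      have "adj v (W ! l) \<longleftrightarrow> l = 0 \<or> l = length W - 1"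
      proof
        assume "adj v (W ! l)"
        then have "W ! l = W ! 0 \<or> W ! l = W ! (length W - 1)"
          using ends Wp(5) by (auto simp: hd_conv_nth last_conv_nth)
        then show "l = 0 \<or> l = length W - 1"
          using Wp(1) l(2) by (auto simp: path_def nth_eq_iff_index_eq)
      next
        assume "l = 0 \<or> l = length W - 1"
        then show "adj v (W ! l)" using Wp by (auto simp: hd_conv_nth last_conv_nth)
      qed
      then show ?thesis using 0 l W(2) by (auto simp: mod_Suc)
    next
      case (Suc i')
      then obtain l where l: "j = Suc l" "l < length W" "i' < l" using ij by (cases j) auto
      have "adj (W ! i') (W ! l) \<longleftrightarrow> l = Suc i'"
        using chord[OF l(3,2)] Wp(1) l(2) by (auto simp: path_def successively_conv_nth)
      then show ?thesis using Suc l by (auto simp: mod_Suc)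
    qed
    have "adj (?cs ! i) (?cs ! j) \<longleftrightarrow> j = Suc i mod ?n \<or> i = Suc j mod ?n"
      if ij: "i < ?n" "j < ?n" for i j
    proof (cases i j rule: linorder_cases)
      case less
      then show ?thesis using step ij by blast
    next
      case equal
      then show ?thesis using ij W(2) by (auto simp: mod_Suc)
    next
      case greater
      then show ?thesis using step[of j i] ij adj_sym by blast
    qed
    moreover have "3 \<le> ?n" using W(2) by simp
    moreover have "distinct ?cs" using Wp(1,2) by (simp add: path_def)
    ultimately show ?thesis unfolding induced_cycle_def by blast
  qed
  have g: "good (hd ?cs) \<phi>" and t: "\<not> monochrome \<phi> (tl ?cs)" using \<phi> nm by auto
  note odd = cycle_digons(1)[OF cyc g t] and dig = cycle_digons(2)[OF cyc g t]
  have subV: "set ?cs \<subseteq> V" using v link_V[OF W(1)] by simp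
  have "set ?cs = V"
    by (rule digon_cycle_spanning[OF kr cyc subV dig])
  moreover have "3 \<le> length ?cs" "distinct ?cs" using cyc by (simp_all only: induced_cycle_def)
  ultimately have "3 \<le> length ?cs \<and> odd (length ?cs) \<and> distinct ?cs \<and> set ?cs = V \<and>
      (\<forall>i<length ?cs. \<forall>j<length ?cs.
         (?cs ! i, ?cs ! j) \<in> E \<longleftrightarrow> j = Suc i mod length ?cs \<or> i = Suc j mod length ?cs)"
    using odd by (intro conjI allI impI dig)
  then have "\<exists>cs. 3 \<le> length cs \<and> odd (length cs) \<and> distinct cs \<and> set cs = V \<and>
      (\<forall>i<length cs. \<forall>j<length cs.
         (cs ! i, cs ! j) \<in> E \<longleftrightarrow> j = Suc i mod length cs \<or> i = Suc j mod length cs)"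
    by (rule exI)
  with k r show ?thesis by (intro conjI)
qed

section \<open>The complete digraph from an end piece\<close>

lemma long_link_exists:
  assumes "adj v v'" "w \<in> V" "w \<noteq> v" "\<not> adj v w"
    and "\<And>x. adj v x \<Longrightarrow> (w, v) \<in> conn (V - {x})"
  shows "\<exists>W. link v W \<and> 3 \<le> length W"
proof -
  let ?N = "{x. adj v x}" and ?X = "insert v {x. adj v x}"
  have v: "v \<in> V" using assms(1) adj_V by blast
  have wX: "w \<notin> ?X" using assms(3,4) by simp
  \<comment> \<open>Walks from \<open>w\<close> to \<open>v\<close> first enter the closed
    neighborhood \<open>?X\<close> at some \<open>x\<close> and, after deletion of \<open>x\<close>,
    at another neighbor \<open>y\<close>. Their predecessors \<open>s1\<close> and \<open>s2\<close>
    lie in one component outside \<open>?X\<close>, and a path between them completes the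
    link.\<close>
  have "(w, v) \<in> conn V" using connected assms(2) v by blast
  from first_hit[OF this assms(2) wX] obtain s1 x where
    s1: "(w, s1) \<in> conn (V - ?X)" "s1 \<in> V - ?X" "x \<in> ?X" "adj s1 x" by blast
  have x: "adj v x" using s1 adj_sym by blast
  have "w \<in> V - {x}" using assms(2,4) x by auto
  from first_hit[OF assms(5)[OF x] this wX] obtain s2 y where
    s2: "(w, s2) \<in> conn (V - {x} - ?X)" "s2 \<in> V - {x} - ?X" "y \<in> ?X" "y \<in> V - {x}" "adj s2 y" by blast
  have y: "adj v y" using s2 adj_sym by blast
  have "V - {x} - ?X = V - ?X" using x by auto
  then have "(s1, s2) \<in> conn (V - ?X)" using s1(1) s2(1) conn_sym conn_trans by metis
  from conn_path[OF this s1(2)] obtain q where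
    q: "path q" "hd q = s1" "last q = s2" "set q \<subseteq> V - ?X" by blast
  have ne: "q \<noteq> []" using q(1) by (simp add: path_def)
  have xy: "x \<noteq> y" "x \<notin> set q" "y \<notin> set q" using s2(4) q(4) x y by auto
  have "path (q @ [y])" using q s2(5) ne xy by (auto simp: path_append) (simp add: path_def)
  then have "path (x # q @ [y])" using xy q(2) s1(4) ne adj_sym by (simp add: path_Cons)
  then have "link v (x # q @ [y])" using x y q(4) ne by (auto simp: link_def Suc_le_eq)
  moreover have "3 \<le> length (x # q @ [y])" using ne by (cases q) auto
  ultimately show ?thesis by blast
qed

text \<open>An end piece plays the role of an end block: A is everything if there is no cut vertex,
  and otherwise a smallest component left by deleting a cut vertex u, with U = {u}.\<close>

lemma end_piece:
  obtains A U where "A \<noteq> {}" "A \<subseteq> V" "U \<subseteq> V" "A \<inter> U = {}" "\<forall>x\<in>U. \<forall>y\<in>U. x = y"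
    "\<forall>v\<in>A. noncut v" "\<forall>v\<in>A. \<forall>w. adj v w \<longrightarrow> w \<in> A \<union> U"
    "\<forall>x\<in>U. \<forall>a\<in>A. \<forall>b\<in>A. (a, b) \<in> conn (V - {x})"
proof (cases "\<forall>v\<in>V. noncut v")
  case True
  then show thesis using that[of V "{}"] V_nonempty adj_V by blast
next
  case False
  define C where "C = (\<lambda>(u, a). {b. (a, b) \<in> conn (V - {u})})"
  define cand where "cand = (\<lambda>(u, a). u \<in> V \<and> \<not> noncut u \<and> a \<in> V - {u})"
  obtain u0 where "u0 \<in> V" "\<not> noncut u0" using False by blast
  then obtain a0 where "cand (u0, a0)" unfolding noncut_def cand_def by blast
  from ex_has_least_nat[of cand, OF this, of "\<lambda>p. card (C p)"] obtain p where
    p: "cand p" "\<forall>q. cand q \<longrightarrow> card (C p) \<le> card (C q)" by blast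
  obtain u a where ua: "p = (u, a)" by (cases p)
  have u: "u \<in> V" "\<not> noncut u" "a \<in> V - {u}" using p(1) ua by (auto simp: cand_def)
  let ?A = "C (u, a)"
  have A: "b \<in> ?A \<longleftrightarrow> (a, b) \<in> conn (V - {u})" for b by (simp add: C_def)
  have AV: "?A \<subseteq> V - {u}" using conn_closed[OF _ u(3)] A by blast
  have closed: "w \<in> ?A \<union> {u}" if v: "v \<in> ?A" "adj v w" for v w
  proof (cases "w = u")
    case False
    then have "(v, w) \<in> conn (V - {u})" using v AV adj_V by (intro conn_step) auto
    then show ?thesis using v(1) A conn_trans by blast
  qed simp
  have nc: "noncut v" if v: "v \<in> ?A" for v
  proof (rule ccontr)
    assume cut: "\<not> noncut v"
    have vV: "v \<in> V" "v \<noteq> u" using v AV by auto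
    \<comment> \<open>A cut vertex \<open>v\<close> separates some \<open>b\<close> from
      \<open>u\<close>. The component of \<open>b\<close> without \<open>v\<close> avoids
      \<open>u\<close>, hence lies in \<open>?A\<close> and misses \<open>v\<close>, against the
      minimality of \<open>?A\<close>.\<close>
    obtain b where b: "b \<in> V - {v}" "(b, u) \<notin> conn (V - {v})"
    proof (rule ccontr)
      assume "\<not> thesis"
      then have "\<forall>b\<in>V - {v}. (b, u) \<in> conn (V - {v})" using that by blast
      then have "noncut v" unfolding noncut_def using conn_sym conn_trans by meson
      then show False using cut by blast
    qed
    have sub: "(b, z) \<in> conn (V - {u})" if "(b, z) \<in> conn (V - {v})" for z
    proof -
      have "(b, z) \<in> conn (V - {v} - {u})" by (rule conn_avoid[OF that b(2)])
      then show ?thesis by (rule conn_mono[rotated]) auto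
    qed
    have bu: "b \<noteq> u" using b(2) by auto
    have "(b, v) \<in> conn V" using connected b(1) vV(1) by blast
    from first_hit[OF this, of "{v}"] b(1) obtain s where
      s: "(b, s) \<in> conn (V - {v})" "s \<in> V" "adj s v" by blast
    have "s \<noteq> u" using s(1) b(2) by blast
    then have "(s, v) \<in> conn (V - {u})" using s(2,3) vV by (intro conn_step) auto
    then have "(b, v) \<in> conn (V - {u})" using sub[OF s(1)] conn_trans by blast
    then have vb: "(a, b) \<in> conn (V - {u})" using v A conn_sym conn_trans by blast
    have "C (v, b) \<subseteq> ?A - {v}"
    proof
      fix z assume "z \<in> C (v, b)"
      then have z: "(b, z) \<in> conn (V - {v})" by (simp add: C_def)
      then have "z \<in> V - {v}" using conn_closed b(1) by blast
      then show "z \<in> ?A - {v}" using sub[OF z] vb A conn_trans by blast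
    qed
    then have "C (v, b) \<subset> ?A" using v by blast
    moreover have "finite ?A" using AV finite_V finite_subset by blast
    ultimately have "card (C (v, b)) < card (C p)" unfolding ua by (rule psubset_card_mono[rotated])
    moreover have "cand (v, b)" using vV cut b(1) by (simp add: cand_def)
    ultimately show False using p(2) not_le by blast
  qed
  show thesis
  proof (rule that[of ?A "{u}"])
    show "?A \<noteq> {}" using A[of a] by auto
    show "\<forall>x\<in>{u}. \<forall>a'\<in>?A. \<forall>b\<in>?A. (a', b) \<in> conn (V - {x})"
      using A conn_sym conn_trans by blast
  qed (use AV u closed nc in auto)
qed

theorem complete_or_odd_cycle:
  "(card V = k * r + 1 \<and> E = {(a, b). a \<in> V \<and> b \<in> V \<and> a \<noteq> b}) \<or>
   k = 2 \<and> r = 1 \<and> (\<exists>cs. 3 \<le> length cs \<and> odd (length cs) \<and> distinct cs \<and> set cs = V \<and>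
      (\<forall>i<length cs. \<forall>j<length cs.
         (cs ! i, cs ! j) \<in> E \<longleftrightarrow> j = Suc i mod length cs \<or> i = Suc j mod length cs))"
proof (cases "\<exists>v W. noncut v \<and> link v W \<and> 3 \<le> length W")
  case True
  then show ?thesis using long_link_odd_cycle by blast
next
  case False
  obtain A U where A: "A \<noteq> {}" "A \<subseteq> V" "U \<subseteq> V" "A \<inter> U = {}" and U1: "\<forall>x\<in>U. \<forall>y\<in>U. x = y"
    and nc: "\<forall>v\<in>A. noncut v" and cl: "\<forall>v\<in>A. \<forall>w. adj v w \<longrightarrow> w \<in> A \<union> U"
    and Ucon: "\<forall>x\<in>U. \<forall>a\<in>A. \<forall>b\<in>A. (a, b) \<in> conn (V - {x})"
    by (rule end_piece)
  have has_nbr: "\<exists>w. adj v w" if v: "v \<in> V" for v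
  proof -
    obtain \<phi> where "good v \<phi>" using good_ex[OF v] by blast
    from other_color[OF this] show ?thesis by blast
  qed
  have full: "adj v w" if v: "v \<in> A" and w: "w \<in> A \<union> U" "w \<noteq> v" for v w
  proof (rule ccontr)
    assume nadj: "\<not> adj v w"
    have vV: "v \<in> V" and wV: "w \<in> V" using v w A by auto
    obtain v' where v': "adj v v'" using has_nbr[OF vV] by blast
    \<comment> \<open>No neighbor \<open>x\<close> separates \<open>w\<close> from \<open>v\<close>:
      in \<open>A\<close> it is not a cut vertex, and if it is the vertex of \<open>U\<close>, then
      \<open>A\<close> stays connected without it.\<close>
    have "(w, v) \<in> conn (V - {x})" if x: "adj v x" for x
    proof -
      have "w \<noteq> x" "v \<noteq> x" using nadj x by auto
      have "x \<in> A \<union> U" using cl v x by blast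
      then show ?thesis
      proof
        assume "x \<in> A"
        then have "noncut x" using nc by blast
        then show ?thesis using \<open>w \<noteq> x\<close> \<open>v \<noteq> x\<close> vV wV by (simp add: noncut_def)
      next
        assume "x \<in> U"
        then have "w \<in> A" using w(1) U1 \<open>w \<noteq> x\<close> by blast
        then show ?thesis using Ucon \<open>x \<in> U\<close> v by blast
      qed
    qed
    from long_link_exists[OF v' wV w(2) nadj this] show False using False nc v by blast
  qed
  have digon: "(v, x) \<in> E \<and> (x, v) \<in> E" if v: "v \<in> A" and x: "x \<in> A \<union> U" "x \<noteq> v" for v x
  proof -
    have vx: "adj v x" by (rule full[OF v x])
    have vV: "v \<in> V" using v A by blast
    obtain \<phi> where \<phi>: "good v \<phi>" using good_ex[OF vV] by blast
    obtain y where y: "adj v y" "\<phi> y \<noteq> \<phi> x" using other_color[OF \<phi>] by blast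
    have yAU: "y \<in> A \<union> U" using cl v y(1) by blast
    have xy: "x \<noteq> y" "y \<noteq> v" using y by auto
    \<comment> \<open>As \<open>U\<close> has at most one vertex, one of \<open>x\<close> and
      \<open>y\<close> lies in \<open>A\<close>, where \<open>full\<close> applies.\<close>
    have axy: "adj x y"
    proof (cases "x \<in> A")
      case True
      then show ?thesis using full yAU xy by blast
    next
      case False
      then have "y \<in> A" using x(1) yAU U1 xy by blast
      then show ?thesis using full[of y x] x(1) xy adj_sym by blast
    qed
    have cyc: "induced_cycle [v, x, y]"
      by (rule induced_triangle) (use vx axy y(1) xy x(2) adj_sym in \<open>blast | simp\<close>)+
    have "\<not> monochrome \<phi> (tl [v, x, y])" using y(2) unfolding monochrome_def by simp
    note dig = cycle_digons(2)[OF cyc _ this, simplified, OF \<phi>]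
    show ?thesis using dig[of 0 1] dig[of 1 0] by simp
  qed
  have out_A: "{w. (v, w) \<in> E} = A \<union> U - {v}" if v: "v \<in> A" for v
  proof -
    have "w \<in> A \<union> U" "w \<noteq> v" if "(v, w) \<in> E" for w
      using cl v that loopfree unfolding adj_def by blast+
    then show ?thesis using digon[OF v] by blast
  qed
  have fin: "finite (A \<union> U)" using A finite_V finite_subset by blast
  have cardAU: "card (A \<union> U) = k * r + 1"
  proof -
    obtain v where v: "v \<in> A" using A(1) by blast
    have "v \<in> V" using v A(2) by blast
    from out_card[OF this] have "card (A \<union> U - {v}) = k * r" unfolding out_A[OF v] .
    moreover have "v \<in> A \<union> U" using v by blast
    ultimately show ?thesis using card.remove[OF fin, of v] by linarith
  qed
  have nbrs_U: "{w. (x, w) \<in> E} = A" "{w. (w, x) \<in> E} = A" if x: "x \<in> U" for x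
  proof -
    have U: "U = {x}" using U1 x by blast
    have "card (A \<union> U) = Suc (card A)" using U A(4) fin by simp
    then have cA: "card A = k * r" using cardAU by simp
    have xV: "x \<in> V" using x A by blast
    have xA: "x \<notin> A" using x A by blast
    \<comment> \<open>The digons to \<open>A\<close> already account for the degree
      \<open>k * r\<close> of \<open>x\<close>, so the attaching vertex has no neighbors outside the
      end piece.\<close>
    have "A \<subseteq> {w. (x, w) \<in> E}" "A \<subseteq> {w. (w, x) \<in> E}" using digon x xA by blast+
    then show "{w. (x, w) \<in> E} = A" "{w. (w, x) \<in> E} = A"
      using card_subset_eq[OF finite_nbrs(1)[of x]] card_subset_eq[OF finite_nbrs(2)[of x]]
        cA out_card[OF xV] in_card[OF xV] by metis+
  qed
  have V: "A \<union> U = V"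
  proof (rule closed_eq_V[OF connected])
    fix a w assume "a \<in> A \<union> U" "adj a w"
    then show "w \<in> A \<union> U" using cl nbrs_U unfolding adj_def by blast
  qed (use A in auto)
  have "(a, b) \<in> E" if "a \<in> V" "b \<in> V" "a \<noteq> b" for a b
  proof (cases "a \<in> A")
    case True
    then show ?thesis using digon that V by blast
  next
    case False
    then have "b \<in> A" using that V U1 by blast
    then show ?thesis using digon[of b a] that V by blast
  qed
  then have "E = {(a, b). a \<in> V \<and> b \<in> V \<and> a \<noteq> b}" using arcs_V loopfree by blast
  then show ?thesis using cardAU V by blast
qed

end

section \<open>Degrees, choosability and list sizes\<close>

lemma induced_simps [simp]:
  "pverts (induced X S) = S" "parcs (induced X S) = {a \<in> parcs X. fst a \<in> S \<and> snd a \<in> S}"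
  by (simp_all add: induced_def)

lemma induced_induced: "T \<subseteq> S \<Longrightarrow> induced (induced X S) T = induced X T"
  by (auto simp: induced_def)

lemma induced_empty: "induced X {} = induced Y {}"
  by (auto simp: induced_def)

lemma out_degree_pair: "out_degree (with_proj X) v = card {w. (v, w) \<in> parcs X}"
proof -
  have "out_arcs (with_proj X) v = Pair v ` {w. (v, w) \<in> parcs X}"
    by (force simp: out_arcs_def)
  then show ?thesis by (simp add: out_degree_def card_image inj_on_def)
qed

lemma in_degree_pair: "in_degree (with_proj X) v = card {w. (w, v) \<in> parcs X}"
proof -
  have "in_arcs (with_proj X) v = (\<lambda>w. (w, v)) ` {w. (w, v) \<in> parcs X}"
    by (force simp: in_arcs_def)
  then show ?thesis by (simp add: in_degree_def card_image inj_on_def)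
qed

lemma degree_CR:
  assumes "K \<in> CR P" "v \<in> pverts K"
  shows "d_out P \<le> card {w. (v, w) \<in> parcs K}" "d_in P \<le> card {w. (w, v) \<in> parcs K}"
proof -
  have fin: "finite (pverts K)"
    using assms(1) by (auto simp: CR_def intro: pair_fin_digraph.pair_finite_verts pair_digraph.axioms)
  have "d_out P \<le> min_out_degree K"
    unfolding d_out_def by (rule cINF_lower[OF _ assms(1)]) simp
  also have "\<dots> \<le> out_degree (with_proj K) v"
    unfolding min_out_degree_def using fin assms(2) by simp
  finally show "d_out P \<le> card {w. (v, w) \<in> parcs K}" by (simp add: out_degree_pair)
  have "d_in P \<le> min_in_degree K"
    unfolding d_in_def by (rule cINF_lower[OF _ assms(1)]) simp
  also have "\<dots> \<le> in_degree (with_proj K) v"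
    unfolding min_in_degree_def using fin assms(2) by simp
  finally show "d_in P \<le> card {w. (w, v) \<in> parcs K}" by (simp add: in_degree_pair)
qed

definition choosable :: "'v pair_pre_digraph set \<Rightarrow> 'v pair_pre_digraph \<Rightarrow> nat \<Rightarrow> bool" where
  "choosable P X k \<longleftrightarrow> (\<forall>L. k_assignment X k L \<longrightarrow> (\<exists>\<phi>. list_coloring P X L \<phi>))"

lemma list_chi_le: "choosable P X k \<Longrightarrow> list_chi P X \<le> k"
  unfolding list_chi_def choosable_def by (rule Least_le)

text \<open>A value defined by \<open>LEAST\<close> has its property only once some witness is
  known; \<open>choosable_exists\<close> provides one.\<close>

lemma choosable_list_chi: "choosable P X k \<Longrightarrow> choosable P X (list_chi P X)"
  unfolding list_chi_def choosable_def by (rule LeastI)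

text \<open>Lists of exactly \<open>k\<close> colors make the later counts exact, and smaller lists
  cannot create colorings.\<close>

lemma thin_assignment:
  assumes "k_assignment X k L"
  obtains L' where "\<And>v. v \<in> pverts X \<Longrightarrow> L' v \<subseteq> L v \<and> finite (L' v) \<and> card (L' v) = k"
proof -
  have "\<exists>T. T \<subseteq> L v \<and> finite T \<and> card T = k" if v: "v \<in> pverts X" for v
  proof (cases "infinite (L v)")
    case True
    from infinite_arbitrarily_large[OF this] show ?thesis by metis
  next
    case False
    then have "k \<le> card (L v)" using assms v by (auto simp: k_assignment_def)
    from obtain_subset_with_card_n[OF this] show ?thesis
      using False finite_subset by metis
  qed
  then obtain L' where "\<forall>v\<in>pverts X. L' v \<subseteq> L v \<and> finite (L' v) \<and> card (L' v) = k" by metis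
  then show thesis using that by blast
qed

section \<open>Critical digraphs of a reliable property\<close>

locale property_digraph =
  fixes P :: "'v pair_pre_digraph set" and D :: "'v pair_pre_digraph"
  assumes rel: "reliable P" and dout: "1 \<le> d_out P" and din: "1 \<le> d_in P"
    and dig: "pair_digraph D"
begin

sublocale dg: pair_digraph D by (rule dig)

sublocale finite_arcs "pverts D" "parcs D"
proof unfold_locales
  show "(v, v) \<notin> parcs D" for v using dg.no_loops'[of v v] by blast
qed (use dg.pair_finite_verts dg.wellformed' in auto)

abbreviation "V \<equiv> pverts D"
abbreviation "E \<equiv> parcs D"

text \<open>Induced subdigraphs are represented by vertex sets of the fixed digraph
  \<open>D\<close>, which avoids nesting \<open>induced\<close> when minimal uncolorable parts are
  chosen.\<close>

definition proper :: "'v set \<Rightarrow> ('v \<Rightarrow> nat set) \<Rightarrow> ('v \<Rightarrow> nat) \<Rightarrow> bool" where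
  "proper S L \<phi> \<longleftrightarrow> (\<forall>v\<in>S. \<phi> v \<in> L v) \<and> (\<forall>c. induced D {v\<in>S. \<phi> v = c} \<in> P)"

lemma finite_sub: "S \<subseteq> V \<Longrightarrow> finite S"
  by (rule finite_subset[OF _ finite_V])

lemma induced_V [simp]: "induced D V = D"
proof -
  have "{a \<in> E. fst a \<in> V \<and> snd a \<in> V} = E" using dg.wellformed' by force
  then show ?thesis by (simp add: induced_def)
qed

lemma induced_mono: "induced D S \<in> P \<Longrightarrow> T \<subseteq> S \<Longrightarrow> induced D T \<in> P"
  using rel unfolding reliable_def hereditary_def by (metis induced_induced induced_simps(1))

lemma empty_mem: "induced D {} \<in> P"
proof -
  obtain X where "X \<in> P" using rel by (auto simp: reliable_def nontrivial_def)
  then have "induced X {} \<in> P" using rel by (auto simp: reliable_def hereditary_def)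
  then show ?thesis using induced_empty by metis
qed

lemma pair_digraph_induced: "S \<subseteq> V \<Longrightarrow> pair_digraph (induced D S)"
  using dg.no_loops' finite_sub
    finite_subset[of "{a \<in> E. fst a \<in> S \<and> snd a \<in> S}" E, OF _ dg.pair_finite_arcs]
  by unfold_locales auto

lemma list_coloring_induced: "S \<subseteq> V \<Longrightarrow> list_coloring P (induced D S) L \<phi> \<longleftrightarrow> proper S L \<phi>"
proof -
  have "induced (induced D S) {v\<in>S. \<phi> v = c} = induced D {v\<in>S. \<phi> v = c}" for c
    by (rule induced_induced) auto
  then show ?thesis by (simp add: list_coloring_def proper_def)
qed

lemma contains_CR:
  assumes "T \<subseteq> V" "induced D T \<notin> P"
  obtains S where "S \<subseteq> T" "induced D S \<in> CR P"
proof -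
  \<comment> \<open>A vertex set of least size outside \<open>P\<close> returns to \<open>P\<close>
    whenever a vertex is deleted, which is criticality.\<close>
  obtain S where S: "S \<subseteq> T" "induced D S \<notin> P"
    and least: "\<And>S'. S' \<subseteq> T \<Longrightarrow> induced D S' \<notin> P \<Longrightarrow> card S \<le> card S'"
    using ex_has_least_nat[of "\<lambda>S. S \<subseteq> T \<and> induced D S \<notin> P" T card] assms(2) by blast
  have fin: "finite S" by (rule finite_sub) (use S(1) assms(1) in auto)
  have "induced D (S - {v}) \<in> P" if "v \<in> S" for v
  proof (rule ccontr)
    assume "induced D (S - {v}) \<notin> P"
    then have "card S \<le> card (S - {v})" using least[of "S - {v}"] S(1) by blast
    then show False using card_Diff1_less[OF fin that] by linarith
  qed
  then have "\<forall>v\<in>S. induced (induced D S) (S - {v}) \<in> P"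
    using induced_induced[of "S - {v}" S D for v] by simp
  then have "induced D S \<in> CR P"
    using S assms(1) pair_digraph_induced unfolding CR_def by simp
  then show thesis using that S(1) by blast
qed

text \<open>A critical subdigraph inside \<open>T\<close> must contain \<open>v\<close>, since
  \<open>P\<close> is hereditary and \<open>T - {v}\<close> induces a member; its degrees at
  \<open>v\<close> give the bounds.\<close>

lemma dense:
  assumes "T \<subseteq> V" "induced D T \<notin> P" "v \<in> T" "induced D (T - {v}) \<in> P"
  shows "d_out P \<le> card {w\<in>T. (v, w) \<in> E}" "d_in P \<le> card {w\<in>T. (w, v) \<in> E}"
proof -
  obtain S where S: "S \<subseteq> T" "induced D S \<in> CR P" using contains_CR[OF assms(1,2)] .
  have vS: "v \<in> S"
  proof (rule ccontr)
    assume "v \<notin> S"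
    then have "induced D S \<in> P" using induced_mono[OF assms(4)] S(1) by blast
    then show False using S(2) by (simp add: CR_def)
  qed
  have fin: "finite T" using assms(1) by (rule finite_sub)
  have "card {w. (v, w) \<in> parcs (induced D S)} \<le> card {w\<in>T. (v, w) \<in> E}"
    "card {w. (w, v) \<in> parcs (induced D S)} \<le> card {w\<in>T. (w, v) \<in> E}"
    by (rule card_mono; use fin S(1) in auto)+
  with degree_CR[OF S(2)] vS show "d_out P \<le> card {w\<in>T. (v, w) \<in> E}" "d_in P \<le> card {w\<in>T. (w, v) \<in> E}"
    by (simp_all) (meson le_trans)+
qed

text \<open>Giving color \<open>c\<close> to \<open>v\<close> would color all of \<open>S\<close>
  unless the enlarged class of \<open>c\<close> fell outside \<open>P\<close>, so
  \<open>dense\<close> applies to that class.\<close>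

lemma uncolored_degree:
  assumes "S \<subseteq> V" "v \<in> S" "proper (S - {v}) L \<phi>" "\<nexists>\<psi>. proper S L \<psi>" "c \<in> L v"
  shows "d_out P \<le> card {w\<in>S - {v}. (v, w) \<in> E \<and> \<phi> w = c}"
    "d_in P \<le> card {w\<in>S - {v}. (w, v) \<in> E \<and> \<phi> w = c}"
proof -
  let ?C = "{w\<in>S - {v}. \<phi> w = c}"
  let ?T = "insert v ?C"
  have "induced D ?T \<notin> P"
  proof
    assume T: "induced D ?T \<in> P"
    have "{w\<in>S. (\<phi>(v := c)) w = c'} = (if c' = c then ?T else {w\<in>S - {v}. \<phi> w = c'})" for c'
      using assms(2) by auto
    then have "proper S L (\<phi>(v := c))" using assms(3,5) T unfolding proper_def by auto
    then show False using assms(4) by blast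
  qed
  moreover have "?T - {v} = ?C" by auto
  moreover have "induced D ?C \<in> P" using assms(3) by (simp add: proper_def)
  moreover have "?T \<subseteq> V" using assms(1,2) by auto
  ultimately have d: "d_out P \<le> card {w\<in>?T. (v, w) \<in> E}" "d_in P \<le> card {w\<in>?T. (w, v) \<in> E}"
    using dense[of ?T v] by auto
  have "{w\<in>?T. (v, w) \<in> E} = {w\<in>S - {v}. (v, w) \<in> E \<and> \<phi> w = c}"
    "{w\<in>?T. (w, v) \<in> E} = {w\<in>S - {v}. (w, v) \<in> E \<and> \<phi> w = c}" using loopfree by auto
  with d show "d_out P \<le> card {w\<in>S - {v}. (v, w) \<in> E \<and> \<phi> w = c}"
    "d_in P \<le> card {w\<in>S - {v}. (w, v) \<in> E \<and> \<phi> w = c}" by simp_all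
qed

lemma uncolored_total_degree:
  assumes "S \<subseteq> V" "v \<in> S" "proper (S - {v}) L \<phi>" "\<nexists>\<psi>. proper S L \<psi>" "finite (L v)"
  shows "card (L v) * d_out P \<le> card {w\<in>S. (v, w) \<in> E}" "card (L v) * d_in P \<le> card {w\<in>S. (w, v) \<in> E}"
proof -
  have fin: "finite S" using assms(1) by (rule finite_sub)
  have "card (L v) * d_out P = (\<Sum>c\<in>L v. d_out P)" by simp
  also have "\<dots> \<le> (\<Sum>c\<in>L v. card {w\<in>{w\<in>S. (v, w) \<in> E}. \<phi> w = c})"
  proof (rule sum_mono)
    fix c assume "c \<in> L v"
    from uncolored_degree(1)[OF assms(1-4) this]
    have "d_out P \<le> card {w\<in>S - {v}. (v, w) \<in> E \<and> \<phi> w = c}" .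
    also have "\<dots> \<le> card {w\<in>{w\<in>S. (v, w) \<in> E}. \<phi> w = c}" by (rule card_mono) (use fin in auto)
    finally show "d_out P \<le> card {w\<in>{w\<in>S. (v, w) \<in> E}. \<phi> w = c}" .
  qed
  also have "\<dots> \<le> card {w\<in>S. (v, w) \<in> E}" by (rule sum_color_classes) (use fin assms(5) in auto)
  finally show "card (L v) * d_out P \<le> card {w\<in>S. (v, w) \<in> E}" .
  have "card (L v) * d_in P = (\<Sum>c\<in>L v. d_in P)" by simp
  also have "\<dots> \<le> (\<Sum>c\<in>L v. card {w\<in>{w\<in>S. (w, v) \<in> E}. \<phi> w = c})"
  proof (rule sum_mono)
    fix c assume "c \<in> L v"
    from uncolored_degree(2)[OF assms(1-4) this]
    have "d_in P \<le> card {w\<in>S - {v}. (w, v) \<in> E \<and> \<phi> w = c}" .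
    also have "\<dots> \<le> card {w\<in>{w\<in>S. (w, v) \<in> E}. \<phi> w = c}" by (rule card_mono) (use fin in auto)
    finally show "d_in P \<le> card {w\<in>{w\<in>S. (w, v) \<in> E}. \<phi> w = c}" .
  qed
  also have "\<dots> \<le> card {w\<in>S. (w, v) \<in> E}" by (rule sum_color_classes) (use fin assms(5) in auto)
  finally show "card (L v) * d_in P \<le> card {w\<in>S. (w, v) \<in> E}" .
qed

text \<open>After thinning the lists, a smallest uncolorable vertex set is chosen; summing
  \<open>uncolored_degree\<close> over the \<open>k\<close> colors at each vertex yields the degree
  bounds.\<close>

lemma not_choosable:
  assumes "S0 \<subseteq> V" "\<not> choosable P (induced D S0) k"
  obtains S L where "S \<subseteq> S0" "S \<noteq> {}" "\<And>v. v \<in> S \<Longrightarrow> finite (L v) \<and> card (L v) = k"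
    "\<nexists>\<psi>. proper S L \<psi>" "\<And>v. v \<in> S \<Longrightarrow> \<exists>\<phi>. proper (S - {v}) L \<phi>"
    "\<And>v. v \<in> S \<Longrightarrow> k * d_out P \<le> card {w\<in>S. (v, w) \<in> E}"
    "\<And>v. v \<in> S \<Longrightarrow> k * d_in P \<le> card {w\<in>S. (w, v) \<in> E}"
proof -
  obtain L0 where L0: "k_assignment (induced D S0) k L0" "\<nexists>\<phi>. list_coloring P (induced D S0) L0 \<phi>"
    using assms(2) unfolding choosable_def by blast
  obtain L where L: "\<And>v. v \<in> S0 \<Longrightarrow> L v \<subseteq> L0 v \<and> finite (L v) \<and> card (L v) = k"
    using thin_assignment[OF L0(1)] by (metis induced_simps(1))
  let ?Q = "\<lambda>S. S \<subseteq> S0 \<and> (\<nexists>\<phi>. proper S L \<phi>)"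
  have "?Q S0"
    using L0(2) L unfolding list_coloring_induced[OF assms(1)] proper_def by blast
  from ex_has_least_nat[of ?Q, OF this, of card]
  obtain S where "?Q S \<and> (\<forall>S'. ?Q S' \<longrightarrow> card S \<le> card S')" by (elim exE)
  then have S: "S \<subseteq> S0" "\<nexists>\<phi>. proper S L \<phi>"
    and least: "S' \<subseteq> S0 \<Longrightarrow> \<nexists>\<phi>. proper S' L \<phi> \<Longrightarrow> card S \<le> card S'" for S'
    by simp_all
  have SV: "S \<subseteq> V" using S(1) assms(1) by (rule subset_trans)
  then have fin: "finite S" by (rule finite_sub)
  have ne: "S \<noteq> {}" using S(2) empty_mem by (auto simp: proper_def)
  have crit: "\<exists>\<phi>. proper (S - {v}) L \<phi>" if "v \<in> S" for v
  proof (rule ccontr)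
    assume "\<nexists>\<phi>. proper (S - {v}) L \<phi>"
    then have "card S \<le> card (S - {v})" using least[of "S - {v}"] S(1) by blast
    then show False using card_Diff1_less[OF fin that] by linarith
  qed
  have Lk: "finite (L v) \<and> card (L v) = k" if "v \<in> S" for v using L S(1) that by blast
  have "k * d_out P \<le> card {w\<in>S. (v, w) \<in> E} \<and> k * d_in P \<le> card {w\<in>S. (w, v) \<in> E}" if v: "v \<in> S" for v
  proof -
    obtain \<phi> where "proper (S - {v}) L \<phi>" using crit[OF v] by blast
    from uncolored_total_degree[OF SV v this S(2)] show ?thesis using Lk[OF v] by simp
  qed
  then show thesis using that[OF S(1) ne Lk S(2) crit] by blast
qed

text \<open>With more colors than vertices, a minimal uncolorable set would need a degree above the
  number of vertices.\<close>

lemma choosable_exists: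
  assumes "S \<subseteq> V"
  shows "choosable P (induced D S) (Suc (card V))"
proof (rule ccontr)
  assume "\<not> ?thesis"
  from not_choosable[OF assms this] obtain S' v where
    S': "S' \<subseteq> S" "v \<in> S'" "Suc (card V) * d_out P \<le> card {w\<in>S'. (v, w) \<in> E}"
    by (metis all_not_in_conv)
  have "Suc (card V) * 1 \<le> Suc (card V) * d_out P" using dout by (rule mult_le_mono2)
  also have "\<dots> \<le> card V" using S' assms by (intro le_trans[OF S'(3)] card_mono finite_V) auto
  finally show False by simp
qed

lemma mem_iff_list_chi:
  assumes "S \<subseteq> V"
  shows "induced D S \<in> P \<longleftrightarrow> list_chi P (induced D S) \<le> 1"
proof
  assume S: "induced D S \<in> P"
  have "choosable P (induced D S) 1" unfolding choosable_def
  proof (intro allI impI)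
    fix L assume L: "k_assignment (induced D S) 1 L"
    have "L v \<noteq> {}" if "v \<in> S" for v
      using L that unfolding k_assignment_def by fastforce
    then have "\<forall>v\<in>S. (SOME c. c \<in> L v) \<in> L v" by (simp add: some_in_eq)
    moreover have "induced D {v \<in> S. (SOME c. c \<in> L v) = c} \<in> P" for c
      by (rule induced_mono[OF S]) auto
    ultimately have "proper S L (\<lambda>v. SOME c. c \<in> L v)" unfolding proper_def by blast
    then show "\<exists>\<phi>. list_coloring P (induced D S) L \<phi>"
      using list_coloring_induced[OF assms] by blast
  qed
  then show "list_chi P (induced D S) \<le> 1" by (rule list_chi_le)
next
  assume "list_chi P (induced D S) \<le> 1"
  moreover have "choosable P (induced D S) (list_chi P (induced D S))"
    using choosable_list_chi choosable_exists[OF assms] .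
  \<comment> \<open>Constant singleton lists serve for the values 0 and 1 alike, and they force all
    of \<open>S\<close> into one color class.\<close>
  moreover have "k_assignment (induced D S) j (\<lambda>_. {0})" if "j \<le> 1" for j
    using that by (simp add: k_assignment_def)
  ultimately obtain \<phi> where "list_coloring P (induced D S) (\<lambda>_. {0}) \<phi>"
    unfolding choosable_def by blast
  then have \<phi>: "proper S (\<lambda>_. {0}) \<phi>" using list_coloring_induced[OF assms] by blast
  then have "{v\<in>S. \<phi> v = 0} = S" unfolding proper_def by auto
  then show "induced D S \<in> P" using \<phi> unfolding proper_def by metis
qed

text \<open>It suffices that two vertices receive different colors: each color class then misses one
  of them and lies in a vertex-deleted subdigraph, which belongs to \<open>P\<close>. A positive
  out-degree supplies the second vertex.\<close>

lemma two_choosable_CR: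
  assumes "D \<in> CR P"
  shows "choosable P D 2"
  unfolding choosable_def
proof (intro allI impI)
  fix L assume L: "k_assignment D 2 L"
  have D: "D \<notin> P" "\<forall>v\<in>V. induced D (V - {v}) \<in> P" using assms by (auto simp: CR_def)
  have "V \<noteq> {}" using D(1) empty_mem induced_V by metis
  then obtain v where v: "v \<in> V" by blast
  have "1 \<le> card {w. (v, w) \<in> E}" using degree_CR(1)[OF assms v] dout by linarith
  then have "{w. (v, w) \<in> E} \<noteq> {}" by (metis card.empty not_one_le_zero)
  then obtain w where "(v, w) \<in> E" by blast
  then have w: "w \<in> V" "w \<noteq> v" using dg.wellformed' dg.no_loops' by blast+
  have L2: "\<exists>c\<in>L u. c \<noteq> d" if "u \<in> V" for u d
  proof (rule ccontr)
    assume "\<not> ?thesis"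
    then have "L u \<subseteq> {d}" by blast
    then have "finite (L u)" "card (L u) \<le> 1"
      using finite_subset card_mono[of "{d}" "L u"] by auto
    then show False using L that unfolding k_assignment_def by fastforce
  qed
  have "\<forall>u\<in>V. \<exists>c. c \<in> L u" using L2 by blast
  then obtain f where f: "\<forall>u\<in>V. f u \<in> L u" by (rule bchoice[THEN exE])
  obtain c where c: "c \<in> L w" "c \<noteq> f v" using L2[OF w(1)] by blast
  let ?\<phi> = "f(w := c)"
  have "induced D {u\<in>V. ?\<phi> u = d} \<in> P" for d
  proof -
    have "\<exists>x\<in>V. {u\<in>V. ?\<phi> u = d} \<subseteq> V - {x}"
    proof (cases "d = c")
      case True
      then show ?thesis using c(2) v w by (intro bexI[of _ v]) auto
    next
      case False
      then show ?thesis using w by (intro bexI[of _ w]) auto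
    qed
    then show ?thesis using D(2) induced_mono by metis
  qed
  then have "list_coloring P D L ?\<phi>" using f c(1) unfolding list_coloring_def by simp
  then show "\<exists>\<phi>. list_coloring P D L \<phi>" by blast
qed

lemma CR_iff_crit: "D \<in> CR P \<longleftrightarrow> D \<in> list_crit P 2"
proof -
  have D: "D \<in> P \<longleftrightarrow> list_chi P D \<le> 1" using mem_iff_list_chi[of V] by simp
  have "D \<in> CR P \<Longrightarrow> D \<in> list_crit P 2"
  proof -
    assume C: "D \<in> CR P"
    have "list_chi P D \<le> 2" by (rule list_chi_le[OF two_choosable_CR[OF C]])
    moreover have "\<not> list_chi P D \<le> 1" using C D by (simp add: CR_def)
    ultimately have chi: "list_chi P D = 2" by linarith
    have "list_chi P (induced D S) < 2" if S: "S \<subset> V" for S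
    proof -
      obtain v where "v \<in> V" "S \<subseteq> V - {v}" using S by blast
      then have "induced D S \<in> P" using C induced_mono unfolding CR_def by blast
      then show ?thesis using mem_iff_list_chi[of S] S by auto
    qed
    with chi dig show ?thesis by (simp add: list_crit_def)
  qed
  moreover have "D \<in> list_crit P 2 \<Longrightarrow> D \<in> CR P"
  proof -
    assume "D \<in> list_crit P 2"
    then have "pair_digraph D \<and> list_chi P D = 2 \<and>
        (\<forall>S. S \<subset> V \<longrightarrow> list_chi P (induced D S) < list_chi P D)"
      unfolding list_crit_def by (rule CollectD)
    then have chi: "list_chi P D = 2"
      and less: "\<And>S. S \<subset> V \<Longrightarrow> list_chi P (induced D S) < 2" by metis+
    have "induced D (V - {v}) \<in> P" if "v \<in> V" for v
    proof -
      have "V - {v} \<subset> V" using that by blast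
      then have "list_chi P (induced D (V - {v})) \<le> 1" using less[of "V - {v}"] by simp
      then show ?thesis using mem_iff_list_chi[of "V - {v}"] by blast
    qed
    moreover have "D \<notin> P" using D chi by simp
    ultimately show ?thesis using dig by (simp add: CR_def)
  qed
  ultimately show ?thesis by blast
qed

end

lemma CR_eq_list_crit:
  assumes "reliable P" "1 \<le> d_out P" "1 \<le> d_in P"
  shows "CR P = list_crit P 2"
proof -
  have "D \<in> CR P \<longleftrightarrow> D \<in> list_crit P 2" if "pair_digraph D" for D
  proof -
    interpret property_digraph P D by (rule property_digraph.intro[OF assms that])
    show ?thesis by (rule CR_iff_crit)
  qed
  then show ?thesis unfolding CR_def list_crit_def by blast
qed

section \<open>Isomorphisms with the model digraphs\<close>

lemma digraph_iso_pairI: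
  assumes "pair_wf_digraph H" "bij_betw g (pverts H) (pverts D)"
    "parcs D = map_prod g g ` parcs H"
  shows "digraph_iso (with_proj D) (with_proj H)"
proof -
  interpret H: pair_wf_digraph H by (rule assms(1))
  \<comment> \<open>The map goes from the model \<open>H\<close> to \<open>D\<close>, as vertex
    enumerations do; the isomorphism is reversed at the end.\<close>
  let ?f = "\<lparr>iso_verts = g, iso_arcs = map_prod g g, iso_head = snd, iso_tail = fst\<rparr>"
  have inj: "inj_on g (pverts H)" and img: "g ` pverts H = pverts D"
    using assms(2) by (auto simp: bij_betw_def)
  have "inj_on (map_prod g g) (pverts H \<times> pverts H)" by (rule map_prod_inj_on[OF inj inj])
  then have "inj_on (map_prod g g) (parcs H)"
    by (rule inj_on_subset) (use H.wellformed' in auto)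
  then have "pre_digraph.digraph_isomorphism (with_proj H) ?f"
    using inj H.wf_digraph by (auto simp: pre_digraph.digraph_isomorphism_def)
  moreover have "with_proj D = app_iso ?f (with_proj H)"
    using img assms(3) by (simp add: app_iso_def with_proj_def)
  ultimately have "digraph_iso (with_proj H) (with_proj D)" unfolding digraph_iso_def by blast
  then show ?thesis by (rule digraph_iso_swap[OF H.wf_digraph])
qed

lemma bidirected_complete_arcs:
  "parcs (bidirected (complete_ugraph n)) = {(u, v). u < n \<and> v < n \<and> u \<noteq> v}"
  by (auto simp: bidirected_def complete_ugraph_def doubleton_eq_iff)

lemma bidirected_cycle_arcs:
  assumes "3 \<le> n"
  shows "parcs (bidirected (cycle_ugraph n)) =
    {(u, v). u < n \<and> v < n \<and> (v = Suc u mod n \<or> u = Suc v mod n)}"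
proof -
  have "Suc i mod n < n" "Suc i mod n \<noteq> i" if "i < n" for i
    using that assms by (auto simp: mod_Suc)
  then show ?thesis
    by (auto simp: bidirected_def cycle_ugraph_def doubleton_eq_iff) metis+
qed

lemma iso_complete:
  assumes "finite (pverts D)" "card (pverts D) = n"
    "parcs D = {(a, b). a \<in> pverts D \<and> b \<in> pverts D \<and> a \<noteq> b}"
  shows "digraph_iso (with_proj D) (with_proj (bidirected (complete_ugraph n)))"
proof -
  let ?H = "bidirected (complete_ugraph n)"
  have verts: "pverts ?H = {..<n}" by (simp add: bidirected_def complete_ugraph_def)
  obtain g where g: "bij_betw g {0..<n} (pverts D)"
    using ex_bij_betw_nat_finite[OF assms(1)] assms(2) by auto
  then have bij: "bij_betw g (pverts ?H) (pverts D)" by (simp add: verts lessThan_atLeast0)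
  show ?thesis
  proof (rule digraph_iso_pairI[OF _ bij])
    show "pair_wf_digraph ?H" by unfold_locales (auto simp: bidirected_complete_arcs verts)
    have img: "g ` {..<n} = pverts D" and inj: "inj_on g {..<n}"
      using bij by (auto simp: bij_betw_def verts)
    show "parcs D = map_prod g g ` parcs ?H"
    proof (intro equalityI subsetI)
      fix e assume "e \<in> parcs D"
      then obtain a b where ab: "e = (a, b)" "a \<in> pverts D" "b \<in> pverts D" "a \<noteq> b"
        using assms(3) by auto
      then obtain i j where "i < n" "j < n" "a = g i" "b = g j"
        unfolding img[symmetric] by auto
      with ab show "e \<in> map_prod g g ` parcs ?H"
        by (intro image_eqI[of _ _ "(i, j)"]) (auto simp: bidirected_complete_arcs)
    next
      fix e assume "e \<in> map_prod g g ` parcs ?H"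
      then obtain i j where "i < n" "j < n" "i \<noteq> j" "e = (g i, g j)"
        by (auto simp: bidirected_complete_arcs)
      then show "e \<in> parcs D"
        using img inj unfolding assms(3) by (auto dest: inj_onD)
    qed
  qed
qed

lemma iso_cycle:
  assumes "3 \<le> length cs" "distinct cs" "set cs = pverts D" "parcs D \<subseteq> pverts D \<times> pverts D"
    and arcs: "\<And>i j. i < length cs \<Longrightarrow> j < length cs \<Longrightarrow>
           (cs ! i, cs ! j) \<in> parcs D \<longleftrightarrow> j = Suc i mod length cs \<or> i = Suc j mod length cs"
  shows "digraph_iso (with_proj D) (with_proj (bidirected (cycle_ugraph (length cs))))"
proof -
  let ?n = "length cs"
  let ?H = "bidirected (cycle_ugraph ?n)"
  have verts: "pverts ?H = {..<?n}" by (simp add: bidirected_def cycle_ugraph_def)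
  have bij: "bij_betw ((!) cs) (pverts ?H) (pverts D)"
    unfolding verts assms(3)[symmetric] by (rule bij_betw_nth) (use assms(2) in auto)
  show ?thesis
  proof (rule digraph_iso_pairI[OF _ bij])
    show "pair_wf_digraph ?H"
      by unfold_locales (auto simp: bidirected_cycle_arcs[OF assms(1)] verts)
    show "parcs D = map_prod ((!) cs) ((!) cs) ` parcs ?H"
    proof (intro equalityI subsetI)
      fix e assume e: "e \<in> parcs D"
      then obtain a b where ab: "e = (a, b)" "a \<in> set cs" "b \<in> set cs"
        using assms(3,4) by auto
      then obtain i j where "i < ?n" "j < ?n" "a = cs ! i" "b = cs ! j"
        by (metis in_set_conv_nth)
      with ab e arcs show "e \<in> map_prod ((!) cs) ((!) cs) ` parcs ?H"
        by (intro image_eqI[of _ _ "(i, j)"]) (auto simp: bidirected_cycle_arcs[OF assms(1)])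
    next
      fix e assume "e \<in> map_prod ((!) cs) ((!) cs) ` parcs ?H"
      then obtain i j where "i < ?n" "j < ?n" "j = Suc i mod ?n \<or> i = Suc j mod ?n" "e = (cs ! i, cs ! j)"
        by (auto simp: bidirected_cycle_arcs[OF assms(1)])
      then show "e \<in> parcs D" using arcs by blast
    qed
  qed
qed

lemma iso_K1:
  assumes "pverts D = {v}" "parcs D = {}"
  shows "digraph_iso (with_proj D) (with_proj K1)"
proof (rule digraph_iso_pairI)
  show "pair_wf_digraph K1" by unfold_locales (auto simp: K1_def)
  show "bij_betw (\<lambda>_. v) (pverts K1) (pverts D)" using assms(1) by (auto simp: K1_def bij_betw_def)
  show "parcs D = map_prod (\<lambda>_. v) (\<lambda>_. v) ` parcs K1" using assms(2) by (simp add: K1_def)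
qed

section \<open>The extremal digraph and the exceptional cases\<close>

locale connected_property_digraph = property_digraph +
  assumes conn: "connected (with_proj D)"
begin

lemma V_ne: "V \<noteq> {}"
  using conn by (simp add: connected_conv)

lemma conn_V: "a \<in> V \<Longrightarrow> b \<in> V \<Longrightarrow> (a, b) \<in> conn V"
proof -
  assume a: "a \<in> V" and b: "b \<in> V"
  then have "(a, b) \<in> rtrancl_on V (E\<^sup>s)" using conn by (simp add: connected_conv)
  then show "(a, b) \<in> conn V"
  proof (induction rule: rtrancl_on_induct)
    case (step y z)
    then have "adj y z" by (auto simp: symcl_def adj_def)
    then have "(y, z) \<in> conn V" using step by (intro conn_step)
    then show ?case using step conn_trans by blast
  qed simp
qed

end

text \<open>The situation left by the degree counts when \<open>k\<close> is at least 2: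
  \<open>D\<close> itself is minimal uncolorable and all its degrees are \<open>k * r\<close>. It is
  shown to be an instance of \<open>hole_coloring\<close>.\<close>

locale critical_coloring = connected_property_digraph +
  fixes L :: "'a \<Rightarrow> nat set" and k r :: nat
  assumes k2: "2 \<le> k" and d_out_r: "d_out P = r" and d_in_r: "d_in P = r"
    and Lk: "v \<in> V \<Longrightarrow> finite (L v) \<and> card (L v) = k"
    and out_kr: "v \<in> V \<Longrightarrow> card {w. (v, w) \<in> E} = k * r"
    and in_kr: "v \<in> V \<Longrightarrow> card {w. (w, v) \<in> E} = k * r"
    and uncolorable: "\<nexists>\<phi>. proper V L \<phi>"
    and colorable: "v \<in> V \<Longrightarrow> \<exists>\<phi>. proper (V - {v}) L \<phi>"
begin

definition good :: "'a \<Rightarrow> ('a \<Rightarrow> nat) \<Rightarrow> bool" where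
  "good h \<phi> \<longleftrightarrow> h \<in> V \<and> proper (V - {h}) L \<phi>"

text \<open>Each of the \<open>k\<close> colors needs at least \<open>r\<close> neighbors in either
  direction, and a degree of \<open>k * r\<close> leaves no surplus.\<close>

lemma good_count:
  assumes "good v \<phi>" "c \<in> L v"
  shows "card {w. (v, w) \<in> E \<and> \<phi> w = c} = r" "card {w. (w, v) \<in> E \<and> \<phi> w = c} = r"
proof -
  have v: "v \<in> V" and pr: "proper (V - {v}) L \<phi>" using assms(1) by (auto simp: good_def)
  have eq: "{w\<in>V - {v}. (v, w) \<in> E \<and> \<phi> w = d} = {w\<in>{w. (v, w) \<in> E}. \<phi> w = d}"
    "{w\<in>V - {v}. (w, v) \<in> E \<and> \<phi> w = d} = {w\<in>{w. (w, v) \<in> E}. \<phi> w = d}" for d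
    using dg.wellformed' loopfree by auto
  have "card {w\<in>{w. (v, w) \<in> E}. \<phi> w = c} = r"
  proof (rule color_class_exact[OF finite_nbrs(1)])
    show "r \<le> card {w\<in>{w. (v, w) \<in> E}. \<phi> w = d}" if "d \<in> L v" for d
      using uncolored_degree(1)[OF order_refl v pr uncolorable that] unfolding eq d_out_r .
  qed (use Lk[OF v] out_kr[OF v] assms(2) in auto)
  then show "card {w. (v, w) \<in> E \<and> \<phi> w = c} = r" by simp
  have "card {w\<in>{w. (w, v) \<in> E}. \<phi> w = c} = r"
  proof (rule color_class_exact[OF finite_nbrs(2)])
    show "r \<le> card {w\<in>{w. (w, v) \<in> E}. \<phi> w = d}" if "d \<in> L v" for d
      using uncolored_degree(2)[OF order_refl v pr uncolorable that] unfolding eq d_in_r .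
  qed (use Lk[OF v] in_kr[OF v] assms(2) in auto)
  then show "card {w. (w, v) \<in> E \<and> \<phi> w = c} = r" by simp
qed

lemma good_color_mem:
  assumes "good v \<phi>" "adj v w"
  shows "\<phi> w \<in> L v"
proof -
  have v: "v \<in> V" using assms(1) by (simp add: good_def)
  from assms(2) consider "(v, w) \<in> E" | "(w, v) \<in> E" by (auto simp: adj_def)
  then show ?thesis
  proof cases
    case 1
    show ?thesis
      by (rule colors_in_list[OF finite_nbrs(1)[of v], of _ r])
         (use 1 Lk[OF v] out_kr[OF v] good_count(1)[OF assms(1)] in auto)
  next
    case 2
    show ?thesis
      by (rule colors_in_list[OF finite_nbrs(2)[of v], of _ r])
         (use 2 Lk[OF v] in_kr[OF v] good_count(2)[OF assms(1)] in auto)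
  qed
qed

text \<open>Before the move \<open>v\<close> has exactly \<open>r\<close> out-neighbors and
  \<open>r\<close> in-neighbors of color \<open>\<phi> w\<close>. Uncoloring \<open>w\<close>
  removes one in some direction, so by \<open>dense\<close> the class stays in \<open>P\<close> when
  \<open>v\<close> joins it.\<close>

lemma good_shift:
  assumes "good v \<phi>" "adj v w"
  shows "good w (\<phi>(v := \<phi> w))"
proof -
  let ?c = "\<phi> w" and ?\<phi> = "\<phi>(v := \<phi> w)"
  have v: "v \<in> V" and pr: "proper (V - {v}) L \<phi>" using assms(1) by (auto simp: good_def)
  have w: "w \<in> V" "w \<noteq> v" using assms(2) adj_V by auto
  have cL: "?c \<in> L v" by (rule good_color_mem[OF assms])
  have cls: "induced D {x\<in>V - {v}. \<phi> x = d} \<in> P" for d using pr by (simp add: proper_def)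
  have "induced D {x\<in>V - {w}. ?\<phi> x = d} \<in> P" for d
  proof (cases "d = ?c")
    case False
    have "{x\<in>V - {w}. ?\<phi> x = d} \<subseteq> {x\<in>V - {v}. \<phi> x = d}" using False by auto
    then show ?thesis by (rule induced_mono[OF cls])
  next
    case True
    let ?T = "{x\<in>V - {w}. ?\<phi> x = d}"
    have vT: "v \<in> ?T" using v w True by auto
    have sub: "?T - {v} \<subseteq> {x\<in>V - {v}. \<phi> x = d}" by auto
    have Tc: "\<phi> x = ?c" "x \<noteq> w" if "x \<in> ?T" "x \<noteq> v" for x using that True by auto
    show ?thesis
    proof (rule ccontr)
      assume nP: "induced D ?T \<notin> P"
      have TV: "?T \<subseteq> V" by auto
      note dn = dense[OF TV nP vT induced_mono[OF cls sub]]
      from assms(2) consider "(v, w) \<in> E" | "(w, v) \<in> E" by (auto simp: adj_def)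
      then show False
      proof cases
        case 1
        have "{x\<in>?T. (v, x) \<in> E} \<subset> {x. (v, x) \<in> E \<and> \<phi> x = ?c}"
          using 1 Tc loopfree by blast
        moreover have "finite {x. (v, x) \<in> E \<and> \<phi> x = ?c}" using finite_nbrs(1) by simp
        ultimately have "card {x\<in>?T. (v, x) \<in> E} < card {x. (v, x) \<in> E \<and> \<phi> x = ?c}"
          by (rule psubset_card_mono[rotated])
        then show False using dn(1) d_out_r good_count(1)[OF assms(1) cL] by linarith
      next
        case 2
        have "{x\<in>?T. (x, v) \<in> E} \<subset> {x. (x, v) \<in> E \<and> \<phi> x = ?c}"
          using 2 Tc loopfree by blast
        moreover have "finite {x. (x, v) \<in> E \<and> \<phi> x = ?c}" using finite_nbrs(2) by simp
        ultimately have "card {x\<in>?T. (x, v) \<in> E} < card {x. (x, v) \<in> E \<and> \<phi> x = ?c}"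
          by (rule psubset_card_mono[rotated])
        then show False using dn(2) d_in_r good_count(2)[OF assms(1) cL] by linarith
      qed
    qed
  qed
  then show ?thesis using pr cL w(1) unfolding good_def proper_def by auto
qed

sublocale hole_coloring V E L k r good
proof unfold_locales
  show "1 \<le> r" using dout d_out_r by simp
  show "\<exists>\<phi>. good v \<phi>" if "v \<in> V" for v using colorable[OF that] that by (auto simp: good_def)
  show "good w (\<phi>(v := \<phi> w))" if "good v \<phi>" "adj v w" for v w \<phi>
    by (rule good_shift[OF that])
  show "2 \<le> k" by (rule k2)
  show "card (L v) = k" if "v \<in> V" for v using Lk[OF that] by blast
  show "v \<in> V" if "good v \<phi>" for v \<phi> using that by (simp add: good_def)
qed (fact out_kr in_kr good_count V_ne conn_V)+

end

context connected_property_digraph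
begin

lemma brooks:
  assumes out_le: "\<And>v. v \<in> V \<Longrightarrow> card {w. (v, w) \<in> E} \<le> k * d_out P"
    and in_le: "\<And>v. v \<in> V \<Longrightarrow> card {w. (w, v) \<in> E} \<le> k * d_in P"
    and large: "k < list_chi P D"
  shows "digraph_iso (with_proj D) (with_proj K1)
       \<or> (\<exists>r\<ge>1. d_out P = r \<and> d_in P = r \<and>
            ((D \<in> CR P \<and> CR P = list_crit P 2 \<and> diregular r D)
           \<or> (\<exists>k\<ge>1. digraph_iso (with_proj D) (with_proj (bidirected (complete_ugraph (k * r + 1))))
                    \<and> D \<in> list_crit P (k + 1))
           \<or> (r = 1 \<and> (\<exists>n\<ge>3. odd n
                    \<and> digraph_iso (with_proj D) (with_proj (bidirected (cycle_ugraph n)))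
                    \<and> D \<in> list_crit P 3))))"
proof -
  \<comment> \<open>Lower bounds inside \<open>S\<close> meet upper bounds in \<open>D\<close>, so
    no arc joins \<open>S\<close> to the rest. Connectedness gives \<open>S = V\<close>, and all
    degree bounds become equalities.\<close>
  have full: "S = V \<and> (\<forall>v\<in>V. card {w. (v, w) \<in> E} = k * d_out P \<and> card {w. (w, v) \<in> E} = k * d_in P)"
    if S: "S \<subseteq> V" "S \<noteq> {}" and dS: "\<And>v. v \<in> S \<Longrightarrow> k * d_out P \<le> card {w\<in>S. (v, w) \<in> E}"
      "\<And>v. v \<in> S \<Longrightarrow> k * d_in P \<le> card {w\<in>S. (w, v) \<in> E}" for S
  proof -
    have nb: "{w\<in>S. (v, w) \<in> E} = {w. (v, w) \<in> E} \<and> {w\<in>S. (w, v) \<in> E} = {w. (w, v) \<in> E}"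
      if v: "v \<in> S" for v
    proof -
      have vV: "v \<in> V" using v S(1) by blast
      show ?thesis
        by (intro conjI card_seteq finite_nbrs le_trans[OF out_le[OF vV] dS(1)[OF v]]
            le_trans[OF in_le[OF vV] dS(2)[OF v]]) auto
    qed
    then have "S = V" by (intro closed_eq_V[OF conn_V] S) (auto simp: adj_def)
    moreover have "card {w. (v, w) \<in> E} = k * d_out P \<and> card {w. (w, v) \<in> E} = k * d_in P"
      if v: "v \<in> S" for v
    proof -
      have vV: "v \<in> V" using v S(1) by blast
      show ?thesis using dS[OF v] nb[OF v] out_le[OF vV] in_le[OF vV] by (simp add: antisym)
    qed
    ultimately show ?thesis by blast
  qed
  have "\<not> choosable P (induced D V) k" using large list_chi_le[of P D k] by auto
  from not_choosable[OF order_refl this] obtain S L where S: "S \<subseteq> V" "S \<noteq> {}"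
    and L: "\<And>v. v \<in> S \<Longrightarrow> finite (L v) \<and> card (L v) = k"
    and unc: "\<nexists>\<psi>. proper S L \<psi>" and col: "\<And>v. v \<in> S \<Longrightarrow> \<exists>\<phi>. proper (S - {v}) L \<phi>"
    and dS: "\<And>v. v \<in> S \<Longrightarrow> k * d_out P \<le> card {w\<in>S. (v, w) \<in> E}"
      "\<And>v. v \<in> S \<Longrightarrow> k * d_in P \<le> card {w\<in>S. (w, v) \<in> E}" by blast
  have SV: "S = V" and deg: "\<And>v. v \<in> V \<Longrightarrow> card {w. (v, w) \<in> E} = k * d_out P"
    "\<And>v. v \<in> V \<Longrightarrow> card {w. (w, v) \<in> E} = k * d_in P"
    using full[OF S dS] by auto
  show ?thesis
  proof (cases "k = 0")
    case True
    \<comment> \<open>For \<open>k = 0\<close> there are no arcs, and connectedness leaves a single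
      vertex.\<close>
    have "{w. (v, w) \<in> E} = {}" if "v \<in> V" for v using deg(1)[OF that] True finite_nbrs(1)[of v] by simp
    then have E0: "E = {}" using dg.wellformed' by auto
    obtain v where v: "v \<in> V" using V_ne by blast
    have "\<not> adj a w" for a w unfolding adj_def using E0 by simp
    then have "{v} = V" using closed_eq_V[OF conn_V, of "{v}"] v by blast
    then show ?thesis using iso_K1[of D v] E0 by simp
  next
    case False
    \<comment> \<open>Counting the arcs once by tails and once by heads forces
      \<open>d_in P = d_out P\<close>.\<close>
    have "(\<Sum>v\<in>V. card {w. (v, w) \<in> E}) = card (Sigma V (\<lambda>v. {w. (v, w) \<in> E}))"
      by (rule card_SigmaI[symmetric]) (use finite_V finite_nbrs in auto)
    also have "Sigma V (\<lambda>v. {w. (v, w) \<in> E}) = E" using dg.wellformed' by auto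
    finally have e1: "card V * (k * d_out P) = card E" using deg(1) by simp
    have "(\<Sum>v\<in>V. card {w. (w, v) \<in> E}) = card (Sigma V (\<lambda>v. {w. (w, v) \<in> E}))"
      by (rule card_SigmaI[symmetric]) (use finite_V finite_nbrs in auto)
    also have "Sigma V (\<lambda>v. {w. (w, v) \<in> E}) = E\<inverse>" using dg.wellformed' by auto
    finally have e2: "card V * (k * d_in P) = card E" using deg(2) by (simp add: card_inverse)
    have "card V \<noteq> 0" using V_ne finite_V by simp
    then have eq: "d_in P = d_out P" using e1 e2 False by (metis mult_cancel1)
    define r where "r = d_out P"
    have r: "d_out P = r" "d_in P = r" "1 \<le> r" using eq dout by (auto simp: r_def)
    \<comment> \<open>A failure with one more color would require an out-degree above
      \<open>k * d_out P\<close>.\<close>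
    have "choosable P (induced D V) (k + 1)"
    proof (rule ccontr)
      assume "\<not> ?thesis"
      from not_choosable[OF order_refl this] obtain T v where
        T: "T \<subseteq> V" "v \<in> T" "(k + 1) * d_out P \<le> card {w\<in>T. (v, w) \<in> E}"
        by (metis all_not_in_conv)
      have "card {w\<in>T. (v, w) \<in> E} \<le> card {w. (v, w) \<in> E}" by (rule card_mono[OF finite_nbrs(1)]) auto
      also have "\<dots> \<le> k * d_out P" by (rule out_le) (use T in auto)
      finally show False using T(3) dout by simp
    qed
    then have "list_chi P D \<le> k + 1" using list_chi_le by simp
    then have chi: "list_chi P D = k + 1" using large by simp
    \<comment> \<open>A minimal uncolorable set inside \<open>T\<close> would equal \<open>V\<close>
      by \<open>full\<close>; this gives criticality.\<close>
    have "list_chi P (induced D T) < k + 1" if T: "T \<subset> V" for T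
    proof -
      have "choosable P (induced D T) k"
      proof (rule ccontr)
        assume nc: "\<not> ?thesis"
        show False
        proof (rule not_choosable[OF psubset_imp_subset[OF T] nc])
          fix T' L'
          assume T': "T' \<subseteq> T" "T' \<noteq> {}"
            "\<And>v. v \<in> T' \<Longrightarrow> k * d_out P \<le> card {w\<in>T'. (v, w) \<in> E}"
            "\<And>v. v \<in> T' \<Longrightarrow> k * d_in P \<le> card {w\<in>T'. (w, v) \<in> E}"
          have "T' \<subseteq> V" using T'(1) T by blast
          from full[OF this T'(2-4)] have "T' = V" by (rule conjunct1)
          then show False using T'(1) T by blast
        qed
      qed
      from list_chi_le[OF this] show ?thesis by simp
    qed
    then have crit: "D \<in> list_crit P (k + 1)" using chi dig by (simp add: list_crit_def)
    show ?thesis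
    proof (cases "k = 1")
      case True
      \<comment> \<open>For \<open>k = 1\<close> criticality refers to the value 2, which describes
        \<open>CR P\<close>, and all degrees equal \<open>r\<close>.\<close>
      have "CR P = list_crit P 2" by (rule CR_eq_list_crit[OF rel dout din])
      moreover have "D \<in> list_crit P 2" using crit True by (simp add: numeral_2_eq_2)
      moreover have "diregular r D"
        using deg True r by (simp add: diregular_def out_degree_pair in_degree_pair)
      ultimately show ?thesis using r by blast
    next
      case k1: False
      interpret critical_coloring P D L k r
        by unfold_locales (use False k1 r deg L unc col SV in auto)
      from complete_or_odd_cycle show ?thesis
      proof (elim disjE conjE exE)
        assume "card V = k * r + 1" "E = {(a, b). a \<in> V \<and> b \<in> V \<and> a \<noteq> b}"
        then have "digraph_iso (with_proj D) (with_proj (bidirected (complete_ugraph (k * r + 1))))"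
          by (rule iso_complete[OF finite_V])
        moreover have "1 \<le> k" using k2 by simp
        ultimately show ?thesis using r crit by blast
      next
        fix cs assume cs: "k = 2" "r = 1" "3 \<le> length cs" "odd (length cs)" "distinct cs" "set cs = V"
          "\<forall>i<length cs. \<forall>j<length cs.
             (cs ! i, cs ! j) \<in> E \<longleftrightarrow> j = Suc i mod length cs \<or> i = Suc j mod length cs"
        have "digraph_iso (with_proj D) (with_proj (bidirected (cycle_ugraph (length cs))))"
          by (rule iso_cycle[OF cs(3,5,6) arcs_V]) (use cs(7) in blast)
        moreover have "D \<in> list_crit P 3" using crit cs(1) by (simp add: numeral_3_eq_3)
        ultimately show ?thesis using r cs(2-4) by blast
      qed
    qed
  qed
qed

end

theorem theorem13:
  fixes P :: "'v::infinite pair_pre_digraph set" and D :: "'v pair_pre_digraph"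
  assumes "reliable P"
    and "1 \<le> d_out P" and "1 \<le> d_in P"
    and "pair_digraph D" and "connected (with_proj D)"
  shows "int (list_chi P D) \<le>
           max \<lceil>real (max_out_degree D) / real (d_out P)\<rceil> \<lceil>real (max_in_degree D) / real (d_in P)\<rceil>
       \<or> digraph_iso (with_proj D) (with_proj K1)
       \<or> (\<exists>r\<ge>1. d_out P = r \<and> d_in P = r \<and>
            ((D \<in> CR P \<and> CR P = list_crit P 2 \<and> diregular r D)
           \<or> (\<exists>k\<ge>1. digraph_iso (with_proj D) (with_proj (bidirected (complete_ugraph (k * r + 1))))
                    \<and> D \<in> list_crit P (k + 1))
           \<or> (r = 1 \<and> (\<exists>n\<ge>3. odd n
                    \<and> digraph_iso (with_proj D) (with_proj (bidirected (cycle_ugraph n)))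
                    \<and> D \<in> list_crit P 3))))"
proof (cases "int (list_chi P D) \<le>
           max \<lceil>real (max_out_degree D) / real (d_out P)\<rceil> \<lceil>real (max_in_degree D) / real (d_in P)\<rceil>")
  case False
  let ?m = "max \<lceil>real (max_out_degree D) / real (d_out P)\<rceil> \<lceil>real (max_in_degree D) / real (d_in P)\<rceil>"
  \<comment> \<open>The ceilings are nonnegative, so \<open>nat\<close> changes nothing.\<close>
  define k where "k = nat ?m"
  interpret connected_property_digraph P D
    by (intro connected_property_digraph.intro property_digraph.intro
        connected_property_digraph_axioms.intro assms)
  \<comment> \<open>A degree is at most the maximum \<open>N\<close>, and \<open>N / d\<close> is at
    most its ceiling and so at most \<open>k\<close>.\<close>
  have bound: "n \<le> k * d" if "n \<le> N" "\<lceil>real N / real d\<rceil> \<le> ?m" "1 \<le> d" for n N d :: nat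
  proof -
    have "real N / real d \<le> real k" using that(2) unfolding k_def by linarith
    then have "real N \<le> real k * real d" using that(3) by (simp add: divide_le_eq)
    then have "N \<le> k * d" by (metis of_nat_le_iff of_nat_mult)
    with that(1) show ?thesis by simp
  qed
  have "card {w. (v, w) \<in> parcs D} \<le> k * d_out P" if "v \<in> pverts D" for v
  proof (rule bound[OF _ _ assms(2)])
    show "card {w. (v, w) \<in> parcs D} \<le> max_out_degree D"
      unfolding max_out_degree_def out_degree_pair[symmetric] using finite_V that by simp
  qed simp
  moreover have "card {w. (w, v) \<in> parcs D} \<le> k * d_in P" if "v \<in> pverts D" for v
  proof (rule bound[OF _ _ assms(3)])
    show "card {w. (w, v) \<in> parcs D} \<le> max_in_degree D"
      unfolding max_in_degree_def in_degree_pair[symmetric] using finite_V that by simp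
  qed simp
  moreover have "k < list_chi P D"
  proof -
    have "0 \<le> real (max_out_degree D) / real (d_out P)" by simp
    then have "0 \<le> \<lceil>real (max_out_degree D) / real (d_out P)\<rceil>" by linarith
    then show ?thesis using False unfolding k_def by linarith
  qed
  ultimately have "digraph_iso (with_proj D) (with_proj K1)
       \<or> (\<exists>r\<ge>1. d_out P = r \<and> d_in P = r \<and>
            ((D \<in> CR P \<and> CR P = list_crit P 2 \<and> diregular r D)
           \<or> (\<exists>k\<ge>1. digraph_iso (with_proj D) (with_proj (bidirected (complete_ugraph (k * r + 1))))
                    \<and> D \<in> list_crit P (k + 1))
           \<or> (r = 1 \<and> (\<exists>n\<ge>3. odd n
                    \<and> digraph_iso (with_proj D) (with_proj (bidirected (cycle_ugraph n)))
                    \<and> D \<in> list_crit P 3))))"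
    by (rule brooks)
  then show ?thesis by (rule disjI2)
qed (rule disjI1)

end
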